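(* Let $H$ be a separable infinite-dimensional complex Hilbert space. The set of cyclic unitary operators on $H$ is dense, in the operator norm topology, in the set of all unitary operators on $H$.
   Context: An operator $T\in L(H)$ is cyclic if there is $x\in H$ such that the linear span of $\{x,Tx,T^2x,\dots\}$ is norm-dense in $H$. *)

theory Defs
  imports "HOL-Analysis.Analysis"
begin

class complex_inner = real_normed_vector +
  fixes scaleC :: "complex \<Rightarrow> 'a \<Rightarrow> 'a"
    and cinner :: "'a \<Rightarrow> 'a \<Rightarrow> complex"
  assumes scaleR_scaleC: "scaleR r x = scaleC (complex_of_real r) x"
    and scaleC_add_right: "scaleC a (x + y) = scaleC a x + scaleC a y"
    and scaleC_add_left: "scaleC (a + b) x = scaleC a x + scaleC b x"
    and scaleC_scaleC: "scaleC a (scaleC b x) = scaleC (a * b) x"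
    and scaleC_one: "scaleC 1 x = x"
    and cinner_commute: "cinner x y = cnj (cinner y x)"
    and cinner_add_right: "cinner x (y + z) = cinner x y + cinner x z"
    and cinner_scaleC_right: "cinner x (scaleC c y) = c * cinner x y"
    and cinner_self_norm: "cinner x x = complex_of_real ((norm x)\<^sup>2)"

class chilbert = complex_inner + complete_space

definition cspan :: "'a::complex_inner set \<Rightarrow> 'a set" where
  "cspan S = {(\<Sum>x\<in>T. scaleC (c x) x) | T c. finite T \<and> T \<subseteq> S}"

definition infinite_dimensional :: "'a::complex_inner itself \<Rightarrow> bool" where
  "infinite_dimensional _ \<longleftrightarrow> \<not> (\<exists>S::'a set. finite S \<and> cspan S = UNIV)"

definition clinear :: "('a::complex_inner \<Rightarrow> 'b::complex_inner) \<Rightarrow> bool" where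
  "clinear f \<longleftrightarrow> (\<forall>x y. f (x + y) = f x + f y) \<and> (\<forall>c x. f (scaleC c x) = scaleC c (f x))"

definition bounded_clinear :: "('a::complex_inner \<Rightarrow> 'b::complex_inner) \<Rightarrow> bool" where
  "bounded_clinear f \<longleftrightarrow> clinear f \<and> (\<exists>K. \<forall>x. norm (f x) \<le> norm x * K)"

definition is_adjoint :: "('a::complex_inner \<Rightarrow> 'a) \<Rightarrow> ('a \<Rightarrow> 'a) \<Rightarrow> bool" where
  "is_adjoint V T \<longleftrightarrow> (\<forall>x y. cinner (T x) y = cinner x (V y))"

definition unitary :: "('a::complex_inner \<Rightarrow> 'a) \<Rightarrow> bool" where
  "unitary U \<longleftrightarrow> bounded_clinear U \<and>
     (\<exists>V. bounded_clinear V \<and> is_adjoint V U \<and> V \<circ> U = id \<and> U \<circ> V = id)"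

definition cyclic_op :: "('a::complex_inner \<Rightarrow> 'a) \<Rightarrow> bool" where
  "cyclic_op T \<longleftrightarrow> (\<exists>x. closure (cspan (range (\<lambda>n. (T ^^ n) x))) = UNIV)"

end

theory Submission
  imports Defs
begin

text \<open>
  Cutting the spectra of the commuting real and imaginary parts of \<open>U\<close> into short intervals
  approximates \<open>U\<close> in norm by \<open>\<Sum>i. lam i R i\<close>, with finitely many mutually orthogonal projections
  \<open>R i\<close> of sum 1 and unimodular \<open>lam i\<close>. The spectral projection of a symmetric \<open>A\<close> at \<open>a\<close> is the
  orthogonal projection onto the kernel of \<open>\<bar>A - a\<bar> + (A - a)\<close>, and the modulus comes from the square
  root iteration \<open>Y \<mapsto> (S + Y\<^sup>2) / 2\<close>, so no spectral theorem is needed.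

  Choosing an orthonormal basis in each range and moving the eigenvalues slightly so that
  they become pairwise distinct gives a diagonal unitary operator close to \<open>U\<close>. It is cyclic: if all
  coefficients of \<open>x\<close> are nonzero and \<open>y\<close> is orthogonal to all \<open>V\<^sup>n x\<close>, then averaging
  the moments over \<open>n\<close> shows that each coefficient of \<open>y\<close> vanishes.
\<close>

section \<open>Complex inner product spaces\<close>

text \<open>The finite sum is in general not cyclic: if an eigenspace has dimension at least two,
  the orbit of any vector projects into a single line of it. Such a range may even be
  infinite-dimensional, so one eigenvalue may have to be split into infinitely many values on one
  short arc of the unit circle. This costs only the largest single displacement, since both
  operators are diagonal in the same basis.

  Spectral projections are built for symmetric operators only, and \<open>U\<close> is not
  symmetric. Hence each projection is constructed together with the fact that it commutes with every
  symmetric operator commuting with \<open>A\<close>. The projections of the real part then commute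
  with those of the imaginary part, and their products resolve the identity.

  On such a product \<open>U\<close> is close to some a + ib, which need not be unimodular. Since
  \<open>U\<close> preserves norms, the modulus of a + ib differs from 1 by at most the error
  already made, so moving it to the circle at most doubles that error.\<close>

instance chilbert \<subseteq> banach ..

interpretation cvs: vector_space "scaleC :: complex \<Rightarrow> 'a \<Rightarrow> 'a::complex_inner"
  by unfold_locales (simp_all add: scaleC_add_right scaleC_add_left scaleC_scaleC scaleC_one)

lemma cspan_eq_span: "cspan S = cvs.span S"
  unfolding cspan_def cvs.span_explicit by simp

lemma cinner_add_left: "cinner (x + y) z = cinner x z + cinner y z"
  for x y z :: "'a::complex_inner"
  by (metis cinner_commute cinner_add_right complex_cnj_add)

lemma cinner_scaleC_left: "cinner (scaleC c x) y = cnj c * cinner x y"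
  for x y :: "'a::complex_inner"
  by (metis cinner_commute cinner_scaleC_right complex_cnj_mult)

lemma cinner_zero_right [simp]: "cinner x 0 = 0" for x :: "'a::complex_inner"
  using cinner_add_right[of x 0 0] by simp

lemma cinner_zero_left [simp]: "cinner 0 x = 0" for x :: "'a::complex_inner"
  using cinner_add_left[of 0 0 x] by simp

lemma cinner_minus_right: "cinner x (- y) = - cinner x y" for x y :: "'a::complex_inner"
  using cinner_add_right[of x y "- y"] by (simp add: add_eq_0_iff)

lemma cinner_minus_left: "cinner (- x) y = - cinner x y" for x y :: "'a::complex_inner"
  using cinner_add_left[of x "- x" y] by (simp add: add_eq_0_iff)

lemma cinner_diff_right: "cinner x (y - z) = cinner x y - cinner x z"
  for x y z :: "'a::complex_inner"
  using cinner_add_right[of x y "- z"] by (simp add: cinner_minus_right)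

lemma cinner_diff_left: "cinner (x - y) z = cinner x z - cinner y z"
  for x y z :: "'a::complex_inner"
  using cinner_add_left[of x "- y" z] by (simp add: cinner_minus_left)

lemmas cinner_simps = cinner_add_left cinner_add_right cinner_diff_left cinner_diff_right
  cinner_minus_left cinner_minus_right cinner_scaleC_left cinner_scaleC_right

lemma cinner_sum_right: "cinner x (sum f A) = (\<Sum>i\<in>A. cinner x (f i))"
  for x :: "'a::complex_inner"
  by (induction A rule: infinite_finite_induct) (simp_all add: cinner_add_right)

lemma cinner_sum_left: "cinner (sum f A) x = (\<Sum>i\<in>A. cinner (f i) x)"
  for x :: "'a::complex_inner"
  by (induction A rule: infinite_finite_induct) (simp_all add: cinner_add_left)

lemma cinner_eq_zero_commute: "cinner x y = 0 \<longleftrightarrow> cinner y x = 0"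
  for x y :: "'a::complex_inner"
  by (metis cinner_commute complex_cnj_zero)

lemma Re_cinner_self: "Re (cinner x x) = (norm x)\<^sup>2" for x :: "'a::complex_inner"
  by (simp add: cinner_self_norm)

lemma Re_cinner_commute: "Re (cinner x y) = Re (cinner y x)" for x y :: "'a::complex_inner"
  by (subst cinner_commute) simp

lemma cinner_self_eq_zero [simp]: "cinner x x = 0 \<longleftrightarrow> x = 0" for x :: "'a::complex_inner"
  by (simp add: cinner_self_norm)

lemma norm_scaleC [simp]: "norm (scaleC c x) = cmod c * norm x" for x :: "'a::complex_inner"
proof -
  have "complex_of_real ((norm (scaleC c x))\<^sup>2) = complex_of_real ((cmod c * norm x)\<^sup>2)"
    by (simp only: cinner_self_norm[symmetric] power_mult_distrib of_real_mult)
      (simp only: cinner_scaleC_left cinner_scaleC_right complex_norm_square mult_ac)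
  then show ?thesis
    by (simp only: of_real_eq_iff) simp
qed

lemma norm_add_sq: "(norm (x + y))\<^sup>2 = (norm x)\<^sup>2 + (norm y)\<^sup>2 + 2 * Re (cinner x y)"
  for x y :: "'a::complex_inner"
  using Re_cinner_commute[of x y] by (simp add: Re_cinner_self[symmetric] cinner_simps)

lemma norm_diff_sq: "(norm (x - y))\<^sup>2 = (norm x)\<^sup>2 + (norm y)\<^sup>2 - 2 * Re (cinner x y)"
  for x y :: "'a::complex_inner"
  using Re_cinner_commute[of x y] by (simp add: Re_cinner_self[symmetric] cinner_simps)

lemma cauchy_schwarz: "cmod (cinner x y) \<le> norm x * norm y" for x y :: "'a::complex_inner"
proof (cases "y = 0")
  case False
  define c where "c = cinner y x / of_real ((norm y)\<^sup>2)"
  have "cinner x y = cnj c * of_real ((norm y)\<^sup>2)"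
    using False by (simp add: c_def cinner_commute[of x y])
  then have "Re (cinner x (scaleC c y)) = (cmod c)\<^sup>2 * (norm y)\<^sup>2"
    by (simp add: cinner_scaleC_right mult.assoc[symmetric] complex_norm_square[symmetric]
        flip: of_real_power of_real_mult)
  then have "0 \<le> (norm x)\<^sup>2 - (cmod c)\<^sup>2 * (norm y)\<^sup>2"
    using norm_diff_sq[of x "scaleC c y"] zero_le_power2[of "norm (x - scaleC c y)"]
    by (simp add: power_mult_distrib mult.commute)
  then have "(cmod c * norm y)\<^sup>2 \<le> (norm x)\<^sup>2"
    by (simp add: power_mult_distrib)
  then have "cmod c * norm y \<le> norm x"
    by (rule power2_le_imp_le) simp
  moreover have "cmod (cinner x y) = cmod c * (norm y)\<^sup>2"
    using \<open>cinner x y = cnj c * of_real ((norm y)\<^sup>2)\<close> by (simp add: norm_mult norm_power)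
  ultimately show ?thesis
    by (simp add: power2_eq_square mult.assoc[symmetric] mult_right_mono)
qed simp

lemma bounded_linear_cinner_right: "bounded_linear (cinner x)" for x :: "'a::complex_inner"
  by (rule bounded_linear_intro[of _ "norm x"])
    (use cauchy_schwarz[of x] in
      \<open>auto simp: cinner_add_right scaleR_scaleC cinner_scaleC_right scaleR_conv_of_real mult_ac\<close>)

lemma bounded_linear_cinner_left: "bounded_linear (\<lambda>x. cinner x y)" for y :: "'a::complex_inner"
  by (rule bounded_linear_intro[of _ "norm y"])
    (use cauchy_schwarz[of _ y] in
      \<open>auto simp: cinner_add_left scaleR_scaleC cinner_scaleC_left scaleR_conv_of_real mult_ac\<close>)

lemmas tendsto_cinner_right [tendsto_intros] = bounded_linear.tendsto[OF bounded_linear_cinner_right]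
lemmas tendsto_cinner_left [tendsto_intros] = bounded_linear.tendsto[OF bounded_linear_cinner_left]

lemma bounded_linear_scaleC: "bounded_linear (scaleC c :: 'a \<Rightarrow> 'a::complex_inner)"
  by (rule bounded_linear_intro[of _ "cmod c"])
    (auto simp: scaleC_add_right scaleR_scaleC scaleC_scaleC mult_ac)

lemmas tendsto_scaleC [tendsto_intros] = bounded_linear.tendsto[OF bounded_linear_scaleC]

subsection \<open>Orthogonal projection onto a closed subspace\<close>

lemma parallelogram: "(norm (x + y))\<^sup>2 + (norm (x - y))\<^sup>2 = 2 * (norm x)\<^sup>2 + 2 * (norm y)\<^sup>2"
  for x y :: "'a::complex_inner"
  by (simp add: norm_add_sq norm_diff_sq)

lemma norm_half_sum: "norm (x - scaleC (1/2) (y + z)) = norm ((x - y) + (x - z)) / 2"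
  for x y z :: "'a::complex_inner"
proof -
  have "x = scaleC (1/2) (x + x)"
    by (simp add: scaleC_add_right scaleC_one flip: scaleC_add_left)
  then have "x - scaleC (1/2) (y + z) = scaleC (1/2) ((x - y) + (x - z))"
    by (metis (no_types, lifting) add_diff_add cvs.scale_right_diff_distrib)
  then show ?thesis by (simp add: norm_divide)
qed

text \<open>A minimising sequence is Cauchy by the parallelogram law, because midpoints of its
  members stay in \<open>M\<close> and so cannot be closer to \<open>x\<close> than the
  infimum.\<close>

lemma nearest_point_exists:
  fixes M :: "'a::chilbert set"
  assumes M: "cvs.subspace M" and cl: "closed M"
  shows "\<exists>m\<in>M. \<forall>y\<in>M. norm (x - m) \<le> norm (x - y)"
proof -
  define d where "d = Inf ((\<lambda>y. (norm (x - y))\<^sup>2) ` M)"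
  have ne: "M \<noteq> {}" using cvs.subspace_0[OF M] by auto
  have bdd: "bdd_below ((\<lambda>y. (norm (x - y))\<^sup>2) ` M)"
    by (rule bdd_belowI[of _ 0]) auto
  have d_le: "d \<le> (norm (x - y))\<^sup>2" if "y \<in> M" for y
    unfolding d_def using that bdd by (auto intro: cInf_lower)
  have "\<exists>y\<in>M. (norm (x - y))\<^sup>2 < d + 1 / real (Suc n)" for n
  proof -
    have "Inf ((\<lambda>y. (norm (x - y))\<^sup>2) ` M) < d + 1 / real (Suc n)"
      by (simp add: d_def)
    then show ?thesis using ne bdd by (subst (asm) cInf_less_iff) auto
  qed
  then obtain y where yM: "\<And>n. y n \<in> M" and y: "\<And>n. (norm (x - y n))\<^sup>2 < d + 1 / real (Suc n)"
    by metis
  have dist: "(norm (y m - y n))\<^sup>2 \<le> 2 / real (Suc m) + 2 / real (Suc n)" for m n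
  proof -
    have "scaleC (1/2) (y m + y n) \<in> M"
      using M yM by (auto intro: cvs.subspace_scale cvs.subspace_add)
    from d_le[OF this] have "4 * d \<le> (norm ((x - y m) + (x - y n)))\<^sup>2"
      by (simp add: norm_half_sum power_divide)
    then show ?thesis
      using parallelogram[of "x - y m" "x - y n"] y[of m] y[of n]
      by (simp add: norm_minus_commute[of "y m" "y n"])
  qed
  have "Cauchy y"
  proof (rule CauchyI)
    fix e :: real assume "e > 0"
    \<comment> \<open>Chosen so that each of the two terms in \<open>dist\<close> is below
      \<open>e\<^sup>2 / 2\<close>.\<close>
    obtain N where N: "4 / e\<^sup>2 < real N" using reals_Archimedean2 by blast
    have "norm (y m - y n) < e" if "m \<ge> N" "n \<ge> N" for m n
    proof -
      have "2 / real (Suc k) < e\<^sup>2 / 2" if "k \<ge> N" for k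
      proof -
        have "4 / e\<^sup>2 < real (Suc k)" using N that by simp
        then show ?thesis using \<open>e > 0\<close> by (simp add: field_simps)
      qed
      from this[OF that(1)] this[OF that(2)] dist[of m n] have "(norm (y m - y n))\<^sup>2 < e\<^sup>2"
        by simp
      then show ?thesis using \<open>e > 0\<close> by (simp add: power2_less_imp_less)
    qed
    then show "\<exists>N. \<forall>m\<ge>N. \<forall>n\<ge>N. norm (y m - y n) < e" by blast
  qed
  then obtain p where p: "y \<longlonglongrightarrow> p" using Cauchy_convergent convergent_def by blast
  have pM: "p \<in> M" using closed_sequentially[OF cl] yM p by blast
  have "(\<lambda>n. (norm (x - y n))\<^sup>2) \<longlonglongrightarrow> (norm (x - p))\<^sup>2" by (intro tendsto_intros p)
  moreover have "(\<lambda>n. d + 1 / real (Suc n)) \<longlonglongrightarrow> d + 0"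
    by (intro tendsto_intros LIMSEQ_Suc lim_1_over_n)
  ultimately have "(norm (x - p))\<^sup>2 \<le> d"
    using y by (intro LIMSEQ_le[of _ _ _ d]) (auto intro: less_imp_le)
  then show ?thesis using pM d_le by (meson order.trans norm_ge_zero power2_le_imp_le)
qed

lemma orthogonal_projection_exists:
  fixes M :: "'a::chilbert set"
  assumes M: "cvs.subspace M" and cl: "closed M"
  shows "\<exists>m\<in>M. \<forall>y\<in>M. cinner y (x - m) = 0"
proof -
  obtain m where m: "m \<in> M" and min: "\<And>y. y \<in> M \<Longrightarrow> norm (x - m) \<le> norm (x - y)"
    using nearest_point_exists[OF assms] by blast
  have "cinner y (x - m) = 0" if y: "y \<in> M" for y
  proof (rule ccontr)
    assume nz: "cinner y (x - m) \<noteq> 0"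
    then have y0: "norm y > 0" by auto
    \<comment> \<open>The step along \<open>y\<close> that minimises the distance; it would improve
      on the nearest point \<open>m\<close>.\<close>
    define c where "c = cinner y (x - m) / of_real ((norm y)\<^sup>2)"
    have "m + scaleC c y \<in> M" using M m y by (auto intro: cvs.subspace_scale cvs.subspace_add)
    from min[OF this] have "(norm (x - m))\<^sup>2 \<le> (norm ((x - m) - scaleC c y))\<^sup>2"
      by (simp add: diff_diff_eq power_mono)
    also have "\<dots> = (norm (x - m))\<^sup>2 + (cmod c * norm y)\<^sup>2 - 2 * Re (c * cinner (x - m) y)"
      by (simp only: norm_diff_sq norm_scaleC cinner_scaleC_right)
    also have "c * cinner (x - m) y = of_real ((cmod c * norm y)\<^sup>2)"
    proof -
      have "cinner y (x - m) = c * of_real ((norm y)\<^sup>2)" using y0 by (simp add: c_def)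
      then have "cinner (x - m) y = cnj c * of_real ((norm y)\<^sup>2)"
        by (metis cinner_commute complex_cnj_complex_of_real complex_cnj_mult)
      then show ?thesis
        by (simp only: power_mult_distrib of_real_mult complex_norm_square mult.assoc)
    qed
    finally have "cmod c * norm y = 0" by simp
    then show False using nz y0 by (simp add: c_def)
  qed
  then show ?thesis using m by blast
qed

section \<open>Symmetric operators\<close>

lemma
  assumes "bounded_clinear T"
  shows bounded_clinear_add: "T (x + y) = T x + T y"
    and bounded_clinear_scaleC: "T (scaleC c x) = scaleC c (T x)"
    and bounded_clinear_diff: "T (x - y) = T x - T y"
    and bounded_clinear_0: "T 0 = 0"
    and bounded_clinear_bounded_linear: "bounded_linear T"
proof -
  have lin: "T (x + y) = T x + T y" "T (scaleC c x) = scaleC c (T x)" for x y c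
    using assms by (auto simp: bounded_clinear_def clinear_def)
  obtain K where K: "\<And>x. norm (T x) \<le> norm x * K"
    using assms by (auto simp: bounded_clinear_def)
  show bl: "bounded_linear T"
    by (rule bounded_linear_intro[of _ K]) (auto simp: lin scaleR_scaleC K)
  show "T (x + y) = T x + T y" "T (scaleC c x) = scaleC c (T x)"
    by (fact lin)+
  show "T (x - y) = T x - T y" "T 0 = 0"
    using bl by (auto simp: bounded_linear.linear linear_diff linear_0)
qed

lemmas bounded_clinear_simps = bounded_clinear_add bounded_clinear_scaleC bounded_clinear_diff
  bounded_clinear_0

lemma bounded_clinear_sum: "bounded_clinear T \<Longrightarrow> T (sum f A) = (\<Sum>i\<in>A. T (f i))"
  by (rule linear_sum, rule bounded_linear.linear, rule bounded_clinear_bounded_linear)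

lemma bounded_clinear_pos_bound:
  assumes "bounded_clinear T"
  obtains K where "K > 0" "\<And>x. norm (T x) \<le> K * norm x"
  using bounded_linear.pos_bounded[OF bounded_clinear_bounded_linear[OF assms]]
  by (auto simp: mult.commute)

lemma bounded_clinear_intro:
  assumes "\<And>x y. T (x + y) = T x + T y" "\<And>c x. T (scaleC c x) = scaleC c (T x)"
    and "\<And>x. norm (T x) \<le> K * norm x"
  shows "bounded_clinear T"
  using assms by (auto simp: bounded_clinear_def clinear_def mult.commute[of K])

lemma bounded_clinear_intro':
  assumes "\<And>x y. T (x + y) = T x + T y" "\<And>c x. T (scaleC c x) = scaleC c (T x)"
    and "bounded_linear T"
  shows "bounded_clinear T"
  using assms bounded_linear.bounded[OF assms(3)]
  by (auto simp: bounded_clinear_def clinear_def mult.commute)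

definition symop :: "('a::complex_inner \<Rightarrow> 'a) \<Rightarrow> bool" where
  "symop T \<longleftrightarrow> bounded_clinear T \<and> (\<forall>x y. cinner (T x) y = cinner x (T y))"

lemma symop_bounded_clinear: "symop T \<Longrightarrow> bounded_clinear T"
  by (simp add: symop_def)

lemma symop_cinner: "symop T \<Longrightarrow> cinner (T x) y = cinner x (T y)"
  by (simp add: symop_def)

lemmas symop_simps = bounded_clinear_simps[OF symop_bounded_clinear]

lemma symop_0: "symop (\<lambda>x. 0)"
  unfolding symop_def by (auto intro!: bounded_clinear_intro[of _ 0])

lemma symop_id: "symop (\<lambda>x. x)"
  unfolding symop_def by (auto intro!: bounded_clinear_intro[of _ 1])

lemma bounded_clinear_plus:
  "bounded_clinear S \<Longrightarrow> bounded_clinear T \<Longrightarrow> bounded_clinear (\<lambda>x. S x + T x)"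
  by (rule bounded_clinear_intro')
    (auto simp: bounded_clinear_simps scaleC_add_right intro: bounded_linear_add
      bounded_clinear_bounded_linear)

lemma bounded_clinear_scale: "bounded_clinear T \<Longrightarrow> bounded_clinear (\<lambda>x. scaleC c (T x))"
  by (rule bounded_clinear_intro')
    (auto simp: bounded_clinear_simps scaleC_add_right scaleC_scaleC mult_ac
      intro: bounded_linear_compose[OF bounded_linear_scaleC] bounded_clinear_bounded_linear)

lemma bounded_clinear_minus:
  "bounded_clinear S \<Longrightarrow> bounded_clinear T \<Longrightarrow> bounded_clinear (\<lambda>x. S x - T x)"
  by (rule bounded_clinear_intro')
    (auto simp: bounded_clinear_simps cvs.scale_right_diff_distrib intro: bounded_linear_sub
      bounded_clinear_bounded_linear)

lemma bounded_clinear_comp: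
  "bounded_clinear S \<Longrightarrow> bounded_clinear T \<Longrightarrow> bounded_clinear (\<lambda>x. S (T x))"
  by (rule bounded_clinear_intro')
    (auto simp: bounded_clinear_simps intro: bounded_linear_compose bounded_clinear_bounded_linear)

lemma symop_plus: "symop S \<Longrightarrow> symop T \<Longrightarrow> symop (\<lambda>x. S x + T x)"
  by (simp add: symop_def bounded_clinear_plus cinner_simps)

lemma symop_minus: "symop S \<Longrightarrow> symop T \<Longrightarrow> symop (\<lambda>x. S x - T x)"
  by (simp add: symop_def bounded_clinear_minus cinner_simps)

lemma symop_scale: "symop T \<Longrightarrow> symop (\<lambda>x. scaleC (complex_of_real r) (T x))"
  by (simp add: symop_def bounded_clinear_scale cinner_simps)

lemma symop_comp: "symop S \<Longrightarrow> symop T \<Longrightarrow> (\<And>x. S (T x) = T (S x)) \<Longrightarrow> symop (\<lambda>x. S (T x))"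
  by (simp add: symop_def bounded_clinear_comp)

text \<open>Polarization expresses \<open>Re (cinner y (T x))\<close> by the quadratic form at x + y
  and x - y. This turns the form bounds delivered by spectral projections into norm bounds.\<close>

lemma symop_norm_le:
  assumes T: "symop T" and le: "\<And>x. \<bar>Re (cinner x (T x))\<bar> \<le> d * (norm x)\<^sup>2"
  shows "norm (T x) \<le> d * norm x"
proof (cases "T x = 0 \<or> x = 0")
  case False
  then have pos: "norm (T x) > 0" "norm x > 0" by auto
  have pol: "4 * Re (cinner y (T x)) \<le> 2 * d * ((norm x)\<^sup>2 + (norm y)\<^sup>2)" for y
  proof -
    have "Re (cinner x (T y)) = Re (cinner y (T x))"
      by (metis Re_cinner_commute T symop_cinner)
    then have "4 * Re (cinner y (T x))
        = Re (cinner (x + y) (T (x + y))) - Re (cinner (x - y) (T (x - y)))"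
      by (simp add: symop_simps[OF T] cinner_simps)
    also have "\<dots> \<le> d * (norm (x + y))\<^sup>2 + d * (norm (x - y))\<^sup>2"
      using le[of "x + y"] le[of "x - y"] by linarith
    also have "\<dots> = 2 * d * ((norm x)\<^sup>2 + (norm y)\<^sup>2)"
      unfolding distrib_left[symmetric] parallelogram by simp
    finally show ?thesis .
  qed
  \<comment> \<open>The test vector is parallel to \<open>T x\<close> and scaled to the norm of
    \<open>x\<close>, which balances the two squares in \<open>pol\<close>.\<close>
  define r where "r = norm x / norm (T x)"
  define y where "y = scaleC (complex_of_real r) (T x)"
  have "norm y = norm x" "Re (cinner y (T x)) = norm x * norm (T x)"
    using pos by (auto simp: y_def r_def cinner_scaleC_left cinner_self_norm power2_eq_square
        norm_divide)
  with pol[of y] have "norm x * norm (T x) \<le> norm x * (d * norm x)"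
    by (simp add: power2_eq_square algebra_simps)
  then show ?thesis using pos by simp
next
  case True
  then show ?thesis
    using le[of x] symop_simps(4)[OF T] by (auto simp: zero_le_mult_iff)
qed

subsection \<open>The modulus of a symmetric operator\<close>

text \<open>A fixed point satisfies 2Y = S + Y^2, that is (1 - Y)^2 = 1 - S. The iteration thus
  produces a square root of 1 - S using only polynomials in \<open>S\<close>, so whatever commutes
  with \<open>S\<close> commutes with the limit.\<close>

primrec root_iter :: "('a::complex_inner \<Rightarrow> 'a) \<Rightarrow> nat \<Rightarrow> 'a \<Rightarrow> 'a" where
  "root_iter S 0 = (\<lambda>x. 0)"
| "root_iter S (Suc n) = (\<lambda>x. scaleC (1/2) (S x + root_iter S n (root_iter S n x)))"

text \<open>The same iteration for the scalar 1. It is bounded and increasing, and its increments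
  majorise those of the operator iteration for every contraction \<open>S\<close>.\<close>

primrec root_bound :: "nat \<Rightarrow> real" where
  "root_bound 0 = 0"
| "root_bound (Suc n) = (1 + (root_bound n)\<^sup>2) / 2"

lemma root_bound_range: "0 \<le> root_bound n \<and> root_bound n \<le> 1"
  by (induction n) (auto simp: power_le_one)

lemma root_bound_mono: "root_bound n \<le> root_bound (Suc n)"
  using zero_le_power2[of "root_bound n - 1"] by (simp add: power2_eq_square algebra_simps)

lemma root_iter_commute:
  assumes "bounded_clinear T" "\<And>x. T (S x) = S (T x)"
  shows "T (root_iter S n x) = root_iter S n (T x)"
  by (induction n arbitrary: x) (simp_all add: bounded_clinear_simps[OF assms(1)] assms(2))

lemma symop_root_iter: "symop S \<Longrightarrow> symop (root_iter S n)"
proof (induction n)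
  case 0
  then show ?case by (simp add: symop_0)
next
  case (Suc n)
  have "symop (\<lambda>x. root_iter S n (root_iter S n x))"
    by (rule symop_comp[OF Suc.IH Suc.IH refl]) (rule Suc.prems)+
  from symop_scale[OF symop_plus[OF \<open>symop S\<close> this], of "1/2"] show ?case by simp
qed

lemma root_iter_norm_le:
  assumes S: "\<And>x. norm (S x) \<le> norm x"
  shows "norm (root_iter S n x) \<le> root_bound n * norm x"
proof (induction n arbitrary: x)
  case (Suc n)
  have "norm (root_iter S n (root_iter S n x)) \<le> root_bound n * (root_bound n * norm x)"
    by (meson Suc mult_left_mono order.trans root_bound_range)
  with S[of x] norm_triangle_ineq[of "S x" "root_iter S n (root_iter S n x)"]
  have "norm (S x + root_iter S n (root_iter S n x)) \<le> norm x + (root_bound n)\<^sup>2 * norm x"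
    by (simp add: power2_eq_square mult.assoc)
  then show ?case by (simp add: norm_divide distrib_right)
qed simp

text \<open>A difference of squares is split as P(P - Q) + (P - Q)Q. Bounding the factors by the
  scalar iteration gives (p + q)(p - q), which telescopes to the next scalar increment.\<close>

lemma root_iter_diff_le:
  assumes sym: "symop S" and S: "\<And>x. norm (S x) \<le> norm x"
  shows "norm (root_iter S (Suc n) x - root_iter S n x) \<le> (root_bound (Suc n) - root_bound n) * norm x"
proof (induction n arbitrary: x)
  case 0
  then show ?case using S[of x] by (simp add: norm_divide)
next
  case (Suc n)
  let ?Y = "root_iter S" and ?t = root_bound
  define d where "d = ?t (Suc n) - ?t n"
  have d: "d \<ge> 0" using root_bound_mono[of n] by (simp only: d_def)
  have IH: "norm (?Y (Suc n) x - ?Y n x) \<le> d * norm x" for x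
    using Suc unfolding d_def .
  note bl = symop_simps[OF symop_root_iter[OF sym]]
  have "?Y (Suc (Suc n)) x - ?Y (Suc n) x
      = scaleC (1/2) (?Y (Suc n) (?Y (Suc n) x) - ?Y n (?Y n x))"
    by (subst (2) root_iter.simps(2), subst root_iter.simps(2))
      (simp only: cvs.scale_right_diff_distrib[symmetric] add_diff_add diff_self add_0)
  also have "?Y (Suc n) (?Y (Suc n) x) - ?Y n (?Y n x)
      = ?Y (Suc n) (?Y (Suc n) x - ?Y n x) + (?Y (Suc n) (?Y n x) - ?Y n (?Y n x))"
    by (simp only: bl) simp
  finally have "norm (?Y (Suc (Suc n)) x - ?Y (Suc n) x)
      \<le> (norm (?Y (Suc n) (?Y (Suc n) x - ?Y n x)) + norm (?Y (Suc n) (?Y n x) - ?Y n (?Y n x))) / 2"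
    by (simp only: norm_scaleC) (simp add: norm_divide norm_triangle_ineq del: root_iter.simps)
  also have "\<dots> \<le> (?t (Suc n) * (d * norm x) + d * (?t n * norm x)) / 2"
    by (intro divide_right_mono add_mono order.trans[OF root_iter_norm_le[OF S]]
        order.trans[OF IH] mult_left_mono IH root_iter_norm_le[OF S] d)
      (use root_bound_range in auto)
  also have "\<dots> = ((?t (Suc n))\<^sup>2 - (?t n)\<^sup>2) / 2 * norm x"
    unfolding d_def power2_eq_square by (simp add: algebra_simps del: root_bound.simps)
  also have "((?t (Suc n))\<^sup>2 - (?t n)\<^sup>2) / 2 = ?t (Suc (Suc n)) - ?t (Suc n)"
    unfolding root_bound.simps(2)[of "Suc n"] root_bound.simps(2)[of n]
    by (simp add: diff_divide_distrib add_divide_distrib)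
  finally show ?case .
qed

lemma symop_root:
  fixes S :: "'a::chilbert \<Rightarrow> 'a"
  assumes sym: "symop S" and S: "\<And>x. norm (S x) \<le> norm x"
  obtains Y where "symop Y" "\<And>x. norm (Y x) \<le> norm x" "\<And>x. scaleC 2 (Y x) = S x + Y (Y x)"
    "\<And>T x. bounded_clinear T \<Longrightarrow> (\<And>x. T (S x) = S (T x)) \<Longrightarrow> T (Y x) = Y (T x)"
proof -
  let ?Y = "root_iter S" and ?t = root_bound
  have conv_t: "convergent ?t"
    by (rule Bseq_monoseq_convergent)
      (use root_bound_range root_bound_mono in \<open>auto intro!: BseqI'[of _ 1] incseq_SucI incseq_imp_monoseq\<close>)
  have diff: "norm (?Y m x - ?Y n x) \<le> (?t m - ?t n) * norm x" if "n \<le> m" for m n x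
    using that
  proof (induction m rule: dec_induct)
    case (step m)
    from norm_triangle_ineq[of "?Y (Suc m) x - ?Y m x" "?Y m x - ?Y n x"]
    have "norm (?Y (Suc m) x - ?Y n x) \<le> norm (?Y (Suc m) x - ?Y m x) + norm (?Y m x - ?Y n x)"
      by simp
    also have "\<dots> \<le> (?t (Suc m) - ?t m) * norm x + (?t m - ?t n) * norm x"
      by (intro add_mono step root_iter_diff_le sym S)
    finally show ?case by (simp only: distrib_right[symmetric]) simp
  qed simp
  have Cau: "Cauchy (\<lambda>n. ?Y n x)" for x
  proof (rule CauchyI')
    fix e :: real assume "e > 0"
    define e' where "e' = e / (norm x + 1)"
    have "norm x + 1 > 0" by (simp add: add_nonneg_pos)
    then have e': "e' > 0" "e' * norm x < e" using \<open>e > 0\<close> by (auto simp: e'_def field_simps)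
    from convergent_Cauchy[OF conv_t] e'(1) obtain N where
      N: "\<And>m n. m \<ge> N \<Longrightarrow> n \<ge> N \<Longrightarrow> norm (?t m - ?t n) < e'" by (meson CauchyD)
    have "dist (?Y m x) (?Y n x) < e" if "m \<ge> N" "n > m" for m n
    proof -
      have "norm (?Y n x - ?Y m x) \<le> e' * norm x"
        using diff[of m n x] N[of n m] that by (auto intro!: order.trans[OF diff] mult_right_mono)
      then show ?thesis using e' by (simp add: dist_norm norm_minus_commute)
    qed
    then show "\<exists>M. \<forall>m\<ge>M. \<forall>n>m. dist (?Y m x) (?Y n x) < e" by blast
  qed
  define Y where "Y x = lim (\<lambda>n. ?Y n x)" for x
  have lim: "(\<lambda>n. ?Y n x) \<longlonglongrightarrow> Y x" for x
    using Cauchy_convergent[OF Cau] by (simp add: Y_def convergent_LIMSEQ_iff)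
  note bl = symop_simps[OF symop_root_iter[OF sym]]
  have contr: "norm (?Y n x) \<le> norm x" for n x
    using root_iter_norm_le[OF S, of n x] root_bound_range[of n]
    by (meson mult_left_le_one_le norm_ge_zero order.trans)
  have Y_norm: "norm (Y x) \<le> norm x" for x
    by (rule LIMSEQ_le_const2[OF tendsto_norm[OF lim]]) (use contr in blast)
  have Y_add: "Y (x + y) = Y x + Y y" for x y
    using LIMSEQ_unique[OF lim[of "x + y"]] tendsto_add[OF lim[of x] lim[of y]] by (simp add: bl)
  have Y_scale: "Y (scaleC c x) = scaleC c (Y x)" for c x
    using LIMSEQ_unique[OF lim[of "scaleC c x"]] tendsto_scaleC[OF lim[of x]] by (simp add: bl)
  have sym_Y: "symop Y"
    unfolding symop_def
  proof (intro conjI allI)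
    show "bounded_clinear Y"
      by (rule bounded_clinear_intro[of _ 1]) (simp_all add: Y_add Y_scale Y_norm)
    fix x y
    show "cinner (Y x) y = cinner x (Y y)"
      using LIMSEQ_unique[OF tendsto_cinner_left[OF lim[of x], of y]]
        tendsto_cinner_right[OF lim[of y], of x]
      by (simp add: symop_cinner[OF symop_root_iter[OF sym]])
  qed
  have lim2: "(\<lambda>n. ?Y n (?Y n x)) \<longlonglongrightarrow> Y (Y x)" for x
  proof -
    \<comment> \<open>Convergence is only pointwise, so the product is handled by the uniform
      contraction bound on the outer factor.\<close>
    have "(\<lambda>n. ?Y n (?Y n x - Y x)) \<longlonglongrightarrow> 0"
    proof (rule Lim_null_comparison)
      show "\<forall>\<^sub>F n in sequentially. norm (?Y n (?Y n x - Y x)) \<le> norm (?Y n x - Y x)"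
        using contr by simp
      show "(\<lambda>n. norm (?Y n x - Y x)) \<longlonglongrightarrow> 0"
        using lim[of x] by (simp add: LIM_zero_iff tendsto_norm_zero_iff)
    qed
    from tendsto_add[OF this lim[of "Y x"]] show ?thesis by (simp add: bl)
  qed
  have "scaleC 2 (Y x) = S x + Y (Y x)" for x
  proof -
    have "(\<lambda>n. ?Y (Suc n) x) \<longlonglongrightarrow> scaleC (1/2) (S x + Y (Y x))"
      by (simp only: root_iter.simps) (intro tendsto_intros lim2)
    with LIMSEQ_Suc[OF lim[of x]] have "Y x = scaleC (1/2) (S x + Y (Y x))"
      by (rule LIMSEQ_unique)
    then have "scaleC 2 (Y x) = scaleC 2 (scaleC (1/2) (S x + Y (Y x)))" by simp
    then show ?thesis by (simp only: scaleC_scaleC) (simp add: scaleC_one)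
  qed
  moreover have "T (Y x) = Y (T x)" if "bounded_clinear T" "\<And>x. T (S x) = S (T x)" for T x
    using LIMSEQ_unique[OF bounded_linear.tendsto[OF bounded_clinear_bounded_linear[OF that(1)] lim[of x]]]
      lim[of "T x"] by (simp add: root_iter_commute[of T S, OF that])
  ultimately show ?thesis using that[of Y] sym_Y Y_norm by blast
qed

text \<open>Rescaling makes S = 1 - D^2 / K^2 a contraction. The root Y of the iteration gives C =
  K(1 - Y), whose square is K^2 (1 - S) = D^2, and C is nonnegative because Y is a
  contraction.\<close>

lemma symop_modulus:
  fixes D :: "'a::chilbert \<Rightarrow> 'a"
  assumes D: "symop D"
  obtains C where "symop C" "\<And>x. C (C x) = D (D x)" "\<And>x. 0 \<le> Re (cinner x (C x))"
    "\<And>T x. bounded_clinear T \<Longrightarrow> (\<And>x. T (D x) = D (T x)) \<Longrightarrow> T (C x) = C (T x)"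
proof -
  obtain K where K: "K > 0" "\<And>x. norm (D x) \<le> K * norm x"
    using bounded_clinear_pos_bound[OF symop_bounded_clinear[OF D]] by blast
  define k where "k = complex_of_real (1 / K\<^sup>2)"
  define S where "S x = x - scaleC k (D (D x))" for x
  have sym_S: "symop S"
    unfolding S_def k_def
    by (rule symop_minus[OF symop_id symop_scale[OF symop_comp[OF D D refl]]])
  have S_form: "Re (cinner x (S x)) = (norm x)\<^sup>2 - (norm (D x))\<^sup>2 / K\<^sup>2" for x
    by (simp add: S_def k_def cinner_simps symop_cinner[OF D, symmetric] cinner_self_norm
        flip: of_real_power of_real_divide of_real_mult of_real_diff)
  have "norm (S x) \<le> 1 * norm x" for x
  proof (rule symop_norm_le[OF sym_S])
    fix x
    have "(norm (D x))\<^sup>2 \<le> (K * norm x)\<^sup>2"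
      using K by (intro power_mono) auto
    then have "(norm (D x))\<^sup>2 / K\<^sup>2 \<le> (norm x)\<^sup>2"
      using K by (simp add: field_simps power_mult_distrib)
    then show "\<bar>Re (cinner x (S x))\<bar> \<le> 1 * (norm x)\<^sup>2"
      unfolding S_form by (simp add: abs_le_iff)
  qed
  then have "\<And>x. norm (S x) \<le> norm x" by simp
  from symop_root[OF sym_S this] obtain Y where Y: "symop Y" "\<And>x. norm (Y x) \<le> norm x"
    "\<And>x. scaleC 2 (Y x) = S x + Y (Y x)"
    "\<And>T x. bounded_clinear T \<Longrightarrow> (\<And>x. T (S x) = S (T x)) \<Longrightarrow> T (Y x) = Y (T x)"
    by blast
  define C where "C x = scaleC (complex_of_real K) (x - Y x)" for x
  show ?thesis
  proof
    show "symop C" unfolding C_def by (rule symop_scale[OF symop_minus[OF symop_id Y(1)]])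
    fix x
    have "scaleC 2 (Y x) = Y x + Y x"
      by (metis cvs.scale_left_distrib one_add_one scaleC_one)
    then have YY: "Y x + Y x = x - scaleC k (D (D x)) + Y (Y x)"
      using Y(3)[of x] by (simp add: S_def)
    have "C (C x) = scaleC (complex_of_real (K\<^sup>2)) (x - (Y x + Y x) + Y (Y x))"
      by (simp add: C_def symop_simps[OF Y(1)] scaleC_scaleC power2_eq_square
          flip: cvs.scale_right_diff_distrib)
    also have "\<dots> = scaleC (complex_of_real (K\<^sup>2) * k) (D (D x))"
      by (simp add: YY scaleC_scaleC)
    also have "\<dots> = D (D x)"
      using K by (simp add: k_def scaleC_one flip: of_real_power of_real_mult)
    finally show "C (C x) = D (D x)" .
    have "Re (cinner x (Y x)) \<le> norm x * norm (Y x)"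
      using complex_Re_le_cmod cauchy_schwarz order.trans by blast
    also have "\<dots> \<le> (norm x)\<^sup>2"
      using Y(2)[of x] by (simp add: power2_eq_square mult_left_mono)
    finally show "0 \<le> Re (cinner x (C x))"
      using K by (simp add: C_def cinner_simps Re_cinner_self)
  next
    fix T :: "'a \<Rightarrow> 'a" and x assume T: "bounded_clinear T" "\<And>x. T (D x) = D (T x)"
    have "T (Y x) = Y (T x)" for x
      by (rule Y(4)) (simp_all add: S_def T bounded_clinear_simps[OF T(1)])
    then show "T (C x) = C (T x)" by (simp add: C_def bounded_clinear_simps[OF T(1)])
  qed
qed

section \<open>Spectral projections\<close>

definition projop :: "('a::complex_inner \<Rightarrow> 'a) \<Rightarrow> bool" where
  "projop E \<longleftrightarrow> symop E \<and> (\<forall>x. E (E x) = E x)"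

lemma projop_symop: "projop E \<Longrightarrow> symop E"
  by (simp add: projop_def)

lemma projop_idem: "projop E \<Longrightarrow> E (E x) = E x"
  by (simp add: projop_def)

lemma projop_cinner_self: "projop E \<Longrightarrow> cinner (E x) x = complex_of_real ((norm (E x))\<^sup>2)"
  by (metis cinner_self_norm projop_def symop_cinner)

lemma projop_norm_le: "projop E \<Longrightarrow> norm (E x) \<le> norm x"
  using cauchy_schwarz[of "E x" x]
  by (cases "E x = 0") (auto simp: projop_cinner_self power2_eq_square norm_mult)

text \<open>Linearity and idempotence of \<open>E\<close> come from uniqueness of the orthogonal
  decomposition. Uniqueness is exported as well, since it later identifies \<open>E (T x)\<close>
  with \<open>T (E x)\<close>.\<close>

lemma projection_onto_closed_subspace:
  fixes M :: "'a::chilbert set"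
  assumes M: "cvs.subspace M" "closed M"
  obtains E where "projop E" "\<And>x. E x \<in> M" "\<And>x y. y \<in> M \<Longrightarrow> cinner y (x - E x) = 0"
    "\<And>x m. m \<in> M \<Longrightarrow> (\<And>y. y \<in> M \<Longrightarrow> cinner y (x - m) = 0) \<Longrightarrow> E x = m"
proof -
  from orthogonal_projection_exists[OF M] obtain E where
    EM: "\<And>x. E x \<in> M" and orth: "\<And>x y. y \<in> M \<Longrightarrow> cinner y (x - E x) = 0"
    by metis
  have uniq: "E x = m" if m: "m \<in> M" "\<And>y. y \<in> M \<Longrightarrow> cinner y (x - m) = 0" for x m
  proof -
    have "m - E x \<in> M" using M(1) m EM by (auto intro: cvs.subspace_diff)
    from m(2)[OF this] orth[OF this, of x] have "cinner (m - E x) (m - E x) = 0"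
      by (simp add: cinner_diff_right)
    then show ?thesis by simp
  qed
  have cinner_E: "cinner y (E x) = cinner y x" if "y \<in> M" for x y
    using orth[OF that, of x] by (simp add: cinner_diff_right)
  have add: "E (x + y) = E x + E y" for x y
    by (rule uniq) (simp_all add: cvs.subspace_add[OF M(1)] EM cinner_simps cinner_E)
  have scale: "E (scaleC c x) = scaleC c (E x)" for c x
    by (rule uniq) (simp_all add: cvs.subspace_scale[OF M(1)] EM cinner_simps cinner_E)
  have orth': "cinner (x - E x) y = 0" if "y \<in> M" for x y
    using orth[OF that, of x] cinner_eq_zero_commute by blast
  have "(norm (E x))\<^sup>2 \<le> (norm x)\<^sup>2" for x
    using norm_add_sq[of "E x" "x - E x"] orth[OF EM[of x], of x] by simp
  then have le: "norm (E x) \<le> 1 * norm x" for x by simp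
  have "cinner (E x) y = cinner x (E y)" for x y
    using orth[OF EM[of x], of y] orth'[OF EM[of y], of x] by (simp add: cinner_simps)
  then have "symop E" unfolding symop_def
    using bounded_clinear_intro[of E 1, OF add scale le] by simp
  moreover have "E (E x) = E x" for x by (rule uniq) (simp_all add: EM)
  ultimately show ?thesis using that[of E] EM orth uniq by (simp add: projop_def)
qed

lemma symop_shift: "symop A \<Longrightarrow> symop (\<lambda>x. A x - scaleC (complex_of_real a) x)"
  by (rule symop_minus[OF _ symop_scale[OF symop_id]])

text \<open>With \<open>D = A - a\<close> and \<open>C = \<bar>D\<bar>\<close> we have \<open>(C + D) (C - D) = 0\<close>. So \<open>D = - C \<le> 0\<close> on the kernel
  of \<open>C + D\<close>, while the orthogonal complement of this kernel lies in the kernel of \<open>C - D\<close>,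
  where \<open>D = C \<ge> 0\<close>.\<close>

lemma spectral_projection:
  fixes A :: "'a::chilbert \<Rightarrow> 'a" and a :: real
  assumes A: "symop A"
  shows "\<exists>E. projop E \<and> (\<forall>T. symop T \<longrightarrow> (\<forall>x. T (A x) = A (T x)) \<longrightarrow> (\<forall>x. T (E x) = E (T x)))
    \<and> (\<forall>x. Re (cinner (E x) (A (E x))) \<le> a * (norm (E x))\<^sup>2)
    \<and> (\<forall>x. a * (norm (x - E x))\<^sup>2 \<le> Re (cinner (x - E x) (A (x - E x))))"
proof -
  define D where "D x = A x - scaleC (complex_of_real a) x" for x
  have D: "symop D" unfolding D_def by (rule symop_shift[OF A])
  have D_form: "Re (cinner x (D x)) = Re (cinner x (A x)) - a * (norm x)\<^sup>2" for x
    by (simp add: D_def cinner_simps cinner_self_norm del: of_real_power)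
  obtain C where C: "symop C" "\<And>x. C (C x) = D (D x)" "\<And>x. 0 \<le> Re (cinner x (C x))"
    and C_com: "\<And>T x. bounded_clinear T \<Longrightarrow> (\<And>x. T (D x) = D (T x)) \<Longrightarrow> T (C x) = C (T x)"
    using symop_modulus[OF D] by blast
  note lin = symop_simps[OF C(1)] symop_simps[OF D]
  have DC: "D (C x) = C (D x)" for x
    by (rule C_com) (simp_all add: symop_bounded_clinear[OF D])
  define M where "M = {x. C x + D x = 0}"
  have CD: "bounded_clinear (\<lambda>x. C x + D x)"
    by (rule bounded_clinear_plus[OF symop_bounded_clinear[OF C(1)] symop_bounded_clinear[OF D]])
  have M: "cvs.subspace M"
    unfolding cvs.subspace_def M_def mem_Collect_eq by (simp only: bounded_clinear_simps[OF CD]) simp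
  have "closed M"
    unfolding M_def
    by (intro closed_Collect_eq continuous_on_const linear_continuous_on
        bounded_clinear_bounded_linear[OF CD])
  from projection_onto_closed_subspace[OF M this] obtain E where E: "projop E"
    and EM: "\<And>x. E x \<in> M" and orth: "\<And>x y. y \<in> M \<Longrightarrow> cinner y (x - E x) = 0"
    and uniq: "\<And>x m. m \<in> M \<Longrightarrow> (\<And>y. y \<in> M \<Longrightarrow> cinner y (x - m) = 0) \<Longrightarrow> E x = m"
    by blast
  have com: "T (E x) = E (T x)" if T: "symop T" and TA: "\<And>x. T (A x) = A (T x)" for T x
  proof -
    have TD: "T (D x) = D (T x)" for x by (simp add: D_def symop_simps[OF T] TA)
    have TC: "T (C x) = C (T x)" for x
      by (rule C_com) (simp_all add: symop_bounded_clinear[OF T] TD)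
    have TM: "T y \<in> M" if "y \<in> M" for y
    proof -
      have "C (T y) + D (T y) = T (C y + D y)" by (simp add: symop_simps[OF T] TC TD)
      then show ?thesis using that by (simp add: M_def symop_simps(4)[OF T])
    qed
    \<comment> \<open>\<open>T\<close> maps \<open>M\<close> into itself and, being symmetric, also
      its orthogonal complement, so it respects the decomposition of \<open>x\<close>.\<close>
    have "E (T x) = T (E x)"
    proof (rule uniq)
      show "T (E x) \<in> M" by (rule TM[OF EM])
      fix y assume "y \<in> M"
      have "cinner y (T (x - E x)) = cinner (T y) (x - E x)" by (simp add: symop_cinner[OF T])
      then show "cinner y (T x - T (E x)) = 0"
        using orth[OF TM[OF \<open>y \<in> M\<close>]] by (simp add: symop_simps[OF T])
    qed
    then show ?thesis by simp
  qed
  have low: "Re (cinner (E x) (D (E x))) \<le> 0" for x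
  proof -
    have "D (E x) = - C (E x)" using EM[of x] by (simp add: M_def eq_neg_iff_add_eq_0 add.commute)
    then show ?thesis using C(3)[of "E x"] by (simp add: cinner_minus_right)
  qed
  have high: "0 \<le> Re (cinner (x - E x) (D (x - E x)))" for x
  proof -
    define z where "z = x - E x"
    have "C w - D w \<in> M" for w by (simp add: M_def lin C(2) DC)
    \<comment> \<open>The second relation takes w = (C - D)z; moving one factor C - D across the
      inner product makes it the squared norm of (C - D)z.\<close>
    then have "cinner (C z - D z) z = 0" "cinner (C (C z - D z) - D (C z - D z)) z = 0"
      using orth by (simp_all add: z_def)
    then have "cinner (C z - D z) (C z - D z) = 0"
      by (simp add: symop_cinner[OF C(1)] symop_cinner[OF D] cinner_simps)
    then have "D z = C z" by simp
    then show ?thesis using C(3)[of z] unfolding z_def by simp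
  qed
  show ?thesis
    using E com low high unfolding D_form by (intro exI[of _ E]) auto
qed

text \<open>Projections and orthogonality are demanded for all indices, which spares membership
  conditions; the sum condition then forces \<open>R i\<close> to vanish outside
  \<open>J\<close>.\<close>

definition resolution :: "'i set \<Rightarrow> ('i \<Rightarrow> 'a::complex_inner \<Rightarrow> 'a) \<Rightarrow> bool" where
  "resolution J R \<longleftrightarrow> finite J \<and> (\<forall>i. projop (R i)) \<and> (\<forall>i j x. i \<noteq> j \<longrightarrow> R i (R j x) = 0)
    \<and> (\<forall>x. (\<Sum>i\<in>J. R i x) = x)"

lemma
  assumes "resolution J R"
  shows resolution_finite: "finite J"
    and resolution_projop: "projop (R i)"
    and resolution_orth: "i \<noteq> j \<Longrightarrow> R i (R j x) = 0"
    and resolution_sum: "(\<Sum>i\<in>J. R i x) = x"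
  using assms by (auto simp: resolution_def)

lemma resolution_norm:
  assumes "resolution J R"
  shows "(norm x)\<^sup>2 = (\<Sum>i\<in>J. (norm (R i x))\<^sup>2)"
proof -
  have "complex_of_real ((norm x)\<^sup>2) = cinner (\<Sum>i\<in>J. R i x) x"
    by (simp add: resolution_sum[OF assms] cinner_self_norm)
  also have "\<dots> = complex_of_real (\<Sum>i\<in>J. (norm (R i x))\<^sup>2)"
    by (simp add: cinner_sum_left projop_cinner_self[OF resolution_projop[OF assms]])
  finally show ?thesis by (simp only: of_real_eq_iff)
qed

text \<open>\<open>E k\<close> belongs to the grid point \<open>a k\<close>, and \<open>P k\<close>
  is the difference of neighbours. On its range the form of A - a k lies between 0 and d times the
  squared norm.\<close>

lemma spectral_resolution:
  fixes A :: "'a::chilbert \<Rightarrow> 'a"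
  assumes A: "symop A" and A1: "\<And>x. norm (A x) \<le> norm x" and d: "d > 0"
  obtains m P a where "resolution {..<m::nat} P"
    "\<And>T k x. symop T \<Longrightarrow> (\<And>x. T (A x) = A (T x)) \<Longrightarrow> T (P k x) = P k (T x)"
    "\<And>k x. norm (A (P k x) - scaleC (complex_of_real (a k)) (P k x)) \<le> d * norm (P k x)"
proof -
  \<comment> \<open>The grid starts strictly below -1, which forces \<open>E 0\<close> to
    vanish.\<close>
  define a where "a k = - 1 - d + real k * d" for k :: nat
  have "\<forall>k. \<exists>E. projop E \<and> (\<forall>T. symop T \<longrightarrow> (\<forall>x. T (A x) = A (T x)) \<longrightarrow> (\<forall>x. T (E x) = E (T x)))
    \<and> (\<forall>x. Re (cinner (E x) (A (E x))) \<le> a k * (norm (E x))\<^sup>2)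
    \<and> (\<forall>x. a k * (norm (x - E x))\<^sup>2 \<le> Re (cinner (x - E x) (A (x - E x))))"
    using spectral_projection[OF A] by blast
  then obtain E where E: "\<And>k. projop (E k)"
    and com: "\<And>k T x. symop T \<Longrightarrow> (\<And>x. T (A x) = A (T x)) \<Longrightarrow> T (E k x) = E k (T x)"
    and low: "\<And>k x. Re (cinner (E k x) (A (E k x))) \<le> a k * (norm (E k x))\<^sup>2"
    and high: "\<And>k x. a k * (norm (x - E k x))\<^sup>2 \<le> Re (cinner (x - E k x) (A (x - E k x)))"
    by metis
  note sE = projop_symop[OF E]
  note lE = symop_simps[OF sE] and idem = projop_idem[OF E]
  have EA: "A (E k x) = E k (A x)" for k x by (rule com[OF A]) simp
  have EE: "E j (E k x) = E k (E j x)" for j k x by (rule com[OF sE]) (simp add: EA)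
  have form_le: "\<bar>Re (cinner x (A x))\<bar> \<le> (norm x)\<^sup>2" for x
  proof -
    have "\<bar>Re (cinner x (A x))\<bar> \<le> norm x * norm (A x)"
      using abs_Re_le_cmod cauchy_schwarz order.trans by blast
    also have "\<dots> \<le> (norm x)\<^sup>2" using A1[of x] by (simp add: power2_eq_square mult_left_mono)
    finally show ?thesis .
  qed
  have mono: "E j (E k x) = E j x" if "j < k" for j k x
  proof -
    \<comment> \<open>This vector is in the range of \<open>E j\<close> and in the kernel of
      \<open>E k\<close>, so its form is at most \<open>a j\<close> and at least \<open>a k\<close>
      times its squared norm, although a j < a k.\<close>
    define z where "z = E j (x - E k x)"
    have "E j z = z" by (simp add: z_def idem)
    moreover have "z - E k z = z" by (simp add: z_def lE idem EE[of k j])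
    ultimately have "a k * (norm z)\<^sup>2 \<le> a j * (norm z)\<^sup>2"
      using low[of j z] high[of k z] by (simp only:)
    moreover have "a j < a k" using that d by (simp add: a_def)
    ultimately have "z = 0" by (simp add: mult_le_cancel_right)
    then show ?thesis by (simp add: z_def lE)
  qed
  have E0: "E 0 x = 0" for x
  proof -
    have "- ((norm (E 0 x))\<^sup>2) \<le> (- 1 - d) * (norm (E 0 x))\<^sup>2"
      using low[of 0 x] form_le[of "E 0 x"] by (simp add: a_def)
    then have "d * (norm (E 0 x))\<^sup>2 \<le> 0" by (simp add: algebra_simps)
    then show ?thesis using d by (simp add: mult_le_0_iff)
  qed
  \<comment> \<open>Solves a m > 1, so the grid passes the spectrum and \<open>E m\<close> is the
    identity.\<close>
  obtain m :: nat where "(2 + d) / d < real m" using reals_Archimedean2 by blast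
  then have am: "a m > 1" using d by (simp add: a_def field_simps)
  have Em: "E m x = x" for x
  proof -
    have "a m * (norm (x - E m x))\<^sup>2 \<le> 1 * (norm (x - E m x))\<^sup>2"
      using high[of m x] form_le[of "x - E m x"] by simp
    then have "(a m - 1) * (norm (x - E m x))\<^sup>2 \<le> 0" by (simp add: left_diff_distrib)
    then show ?thesis using am by (simp add: mult_le_0_iff)
  qed
  define P where "P k x = E (Suc k) x - E k x" for k x
  have sP: "symop (P k)" for k unfolding P_def by (rule symop_minus[OF sE sE])
  have EE_le: "E j (E k x) = E (min j k) x" for j k x
    using mono[of j k x] mono[of k j x] idem[of j x] EE[of j k x]
    by (cases j k rule: linorder_cases) auto
  have PP: "P k (P l x) = (if k = l then P k x else 0)" for k l x
    by (cases k l rule: linorder_cases) (auto simp: P_def lE EE_le)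
  have P: "projop (P k)" for k by (simp add: projop_def sP PP)
  have "(\<Sum>k<m. P k x) = x" for x
    unfolding P_def by (subst sum_lessThan_telescope) (simp add: Em E0)
  then have res: "resolution {..<m} P" by (simp add: resolution_def P PP)
  have comP: "T (P k x) = P k (T x)" if T: "symop T" "\<And>x. T (A x) = A (T x)" for T k x
    by (simp add: P_def symop_simps[OF T(1)] com[OF T])
  have "norm (A (P k x) - scaleC (complex_of_real (a k)) (P k x)) \<le> d * norm (P k x)" for k x
  proof -
    define T where "T x = A (P k x) - scaleC (complex_of_real (a k)) (P k x)" for x
    have AP: "A (P k x) = P k (A x)" for x by (rule comP[OF A]) simp
    have "symop T" unfolding T_def
      by (rule symop_minus[OF symop_comp[OF A sP AP] symop_scale[OF sP]])
    moreover have "\<bar>Re (cinner x (T x))\<bar> \<le> d * (norm x)\<^sup>2" for x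
    proof -
      define z where "z = P k x"
      have "T x = P k (A z - scaleC (complex_of_real (a k)) z)"
        by (simp add: T_def z_def symop_simps[OF sP] PP AP)
      then have "cinner x (T x) = cinner z (A z - scaleC (complex_of_real (a k)) z)"
        by (simp add: z_def symop_cinner[OF sP])
      then have form: "Re (cinner x (T x)) = Re (cinner z (A z)) - a k * (norm z)\<^sup>2"
        by (simp add: cinner_simps cinner_self_norm del: of_real_power)
      have "E (Suc k) z = z" "z - E k z = z" by (simp_all add: z_def P_def lE EE_le)
      with low[of "Suc k" z] high[of k z]
      have "Re (cinner z (A z)) \<le> a (Suc k) * (norm z)\<^sup>2" "a k * (norm z)\<^sup>2 \<le> Re (cinner z (A z))"
        by simp_all
      moreover have "a (Suc k) = a k + d" by (simp add: a_def algebra_simps)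
      ultimately have "\<bar>Re (cinner x (T x))\<bar> \<le> d * (norm z)\<^sup>2"
        unfolding form by (simp add: distrib_right)
      also have "\<dots> \<le> d * (norm x)\<^sup>2"
        using projop_norm_le[OF P, of k x] d by (simp add: z_def power_mono)
      finally show ?thesis .
    qed
    ultimately have "norm (T (P k x)) \<le> d * norm (P k x)" by (rule symop_norm_le)
    then show ?thesis by (simp add: T_def PP)
  qed
  then show ?thesis using that[of m P a] res comP by blast
qed

section \<open>Approximation of a unitary operator by one with finite spectrum\<close>

lemma unit_complex_near:
  obtains z :: complex where "cmod z = 1" "cmod (c - z) = \<bar>cmod c - 1\<bar>"
proof (cases "c = 0")
  case True
  then show ?thesis using that[of 1] by simp
next
  case False
  have "c - sgn c = of_real (cmod c - 1) * sgn c"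
    using False by (simp add: sgn_div_norm scaleR_conv_of_real field_simps)
  then have "cmod (c - sgn c) = \<bar>cmod c - 1\<bar>"
    using False by (simp only: norm_mult norm_of_real) (simp add: norm_sgn)
  then show ?thesis using that[of "sgn c"] False by (simp add: norm_sgn)
qed

lemma unitaryE:
  fixes U :: "'a::complex_inner \<Rightarrow> 'a"
  assumes "unitary U"
  obtains W where "bounded_clinear U" "bounded_clinear W" "\<And>x y. cinner (U x) y = cinner x (W y)"
    "\<And>x y. cinner (W x) y = cinner x (U y)" "\<And>x. W (U x) = x" "\<And>x. U (W x) = x"
    "\<And>x. norm (U x) = norm x" "\<And>x. norm (W x) = norm x"
proof -
  obtain W where W: "bounded_clinear U" "bounded_clinear W" "\<And>x y. cinner (U x) y = cinner x (W y)"
    and inv: "W \<circ> U = id" "U \<circ> W = id"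
    using assms by (auto simp: unitary_def is_adjoint_def)
  have inv': "W (U x) = x" "U (W x) = x" for x
    using inv by (auto simp: fun_eq_iff)
  have adj: "cinner (W x) y = cinner x (U y)" for x y
    by (metis W(3) cinner_commute)
  have "(norm (U x))\<^sup>2 = (norm x)\<^sup>2" "(norm (W x))\<^sup>2 = (norm x)\<^sup>2" for x
    by (simp_all add: W(3) adj inv' flip: Re_cinner_self)
  then have "norm (U x) = norm x" "norm (W x) = norm x" for x
    by (simp_all add: power2_eq_iff_nonneg)
  then show ?thesis using that W adj inv' by blast
qed

text \<open>With W the adjoint, A = (U + W)/2 and B = (U - W)/(2i); they commute because U W = W U =
  1.\<close>

lemma unitary_cartesian_decomposition:
  fixes U :: "'a::complex_inner \<Rightarrow> 'a"
  assumes "unitary U"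
  obtains A B where "symop A" "symop B" "\<And>x. norm (A x) \<le> norm x" "\<And>x. norm (B x) \<le> norm x"
    "\<And>x. A (B x) = B (A x)" "\<And>x. U x = A x + scaleC \<i> (B x)"
proof -
  obtain W where W: "bounded_clinear U" "bounded_clinear W" "\<And>x y. cinner (U x) y = cinner x (W y)"
    "\<And>x y. cinner (W x) y = cinner x (U y)" "\<And>x. W (U x) = x" "\<And>x. U (W x) = x"
    "\<And>x. norm (U x) = norm x" "\<And>x. norm (W x) = norm x"
    using unitaryE[OF assms] by metis
  note lin = bounded_clinear_simps[OF W(1)] bounded_clinear_simps[OF W(2)]
  define A where "A x = scaleC (1/2) (U x + W x)" for x
  define B where "B x = scaleC (- \<i>/2) (U x - W x)" for x
  show ?thesis
  proof
    have "bounded_clinear A" unfolding A_def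
      by (rule bounded_clinear_scale[OF bounded_clinear_plus[OF W(1,2)]])
    then show "symop A"
      by (auto simp: symop_def A_def cinner_simps W add.commute)
    have "bounded_clinear B" unfolding B_def
      by (rule bounded_clinear_scale[OF bounded_clinear_minus[OF W(1,2)]])
    then show "symop B"
      by (auto simp: symop_def B_def cinner_simps W algebra_simps)
    fix x
    show "norm (A x) \<le> norm x"
      using norm_triangle_ineq[of "U x" "W x"] by (simp add: A_def norm_divide W)
    show "norm (B x) \<le> norm x"
      using norm_triangle_ineq4[of "U x" "W x"] by (simp add: B_def norm_divide W)
    show "A (B x) = B (A x)"
      by (simp only: A_def B_def lin W flip: scaleC_add_right cvs.scale_right_diff_distrib)
        (simp add: scaleC_scaleC)
    have "A x + scaleC \<i> (B x) = scaleC (1/2) (U x + W x) + scaleC (1/2) (U x - W x)"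
      by (simp add: A_def B_def scaleC_scaleC)
    also have "\<dots> = scaleC (1/2) (U x) + scaleC (1/2) (U x)"
      by (simp only: scaleC_add_right[symmetric]) simp
    also have "\<dots> = U x"
      by (simp only: scaleC_add_left[symmetric]) (simp add: scaleC_one)
    finally show "U x = A x + scaleC \<i> (B x)" by simp
  qed
qed

lemma resolution_product:
  assumes P: "resolution I P" and Q: "resolution J Q" and com: "\<And>k l x. P k (Q l x) = Q l (P k x)"
  shows "resolution (I \<times> J) (\<lambda>(k, l) x. P k (Q l x))"
proof -
  note pP = resolution_projop[OF P] and pQ = resolution_projop[OF Q]
  note bP = symop_bounded_clinear[OF projop_symop[OF pP]]
  have "projop (\<lambda>x. P k (Q l x))" for k l
    unfolding projop_def
  proof (intro conjI allI)
    show "symop (\<lambda>x. P k (Q l x))"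
      by (rule symop_comp[of "P k" "Q l", OF projop_symop[OF pP] projop_symop[OF pQ] com])
    show "P k (Q l (P k (Q l x))) = P k (Q l x)" for x
      unfolding com[of k l "Q l x", symmetric] projop_idem[OF pP] projop_idem[OF pQ] ..
  qed
  moreover have "P k (Q l (P k' (Q l' x))) = 0" if "(k, l) \<noteq> (k', l')" for k l k' l' x
  proof -
    have "P k (Q l (P k' (Q l' x))) = P k (P k' (Q l (Q l' x)))"
      unfolding com[of k' l, symmetric] ..
    then show ?thesis
      using that resolution_orth[OF P, of k k'] resolution_orth[OF Q, of l l'] bounded_clinear_0[OF bP]
      by (cases "k = k'") auto
  qed
  moreover have "(\<Sum>(k, l)\<in>I \<times> J. P k (Q l x)) = x" for x
    by (simp add: resolution_sum[OF P] resolution_sum[OF Q] flip: sum.cartesian_product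
        bounded_clinear_sum[OF bP])
  ultimately show ?thesis
    using resolution_finite[OF P] resolution_finite[OF Q]
    by (auto simp: resolution_def split_def)
qed

text \<open>\<open>U\<close> respects the orthogonal pieces, so their errors add in squares and the
  bound does not grow with the number of pieces.\<close>

lemma resolution_approx:
  assumes R: "resolution J R" and U: "bounded_clinear U" "\<And>i x. U (R i x) = R i (U x)"
    and e: "e \<ge> 0" and le: "\<And>i x. norm (U (R i x) - scaleC (lam i) (R i x)) \<le> e * norm (R i x)"
  shows "norm (U x - (\<Sum>i\<in>J. scaleC (lam i) (R i x))) \<le> e * norm x"
proof -
  define z where "z = U x - (\<Sum>i\<in>J. scaleC (lam i) (R i x))"
  note bR = symop_bounded_clinear[OF projop_symop[OF resolution_projop[OF R]]]
  have Rz: "R i z = U (R i x) - scaleC (lam i) (R i x)" if "i \<in> J" for i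
  proof -
    have "R i (\<Sum>j\<in>J. scaleC (lam j) (R j x)) = (\<Sum>j\<in>J. scaleC (lam j) (R i (R j x)))"
      by (simp add: bounded_clinear_sum[OF bR] bounded_clinear_scaleC[OF bR])
    also have "\<dots> = (\<Sum>j\<in>J. if j = i then scaleC (lam i) (R i x) else 0)"
      using resolution_orth[OF R] projop_idem[OF resolution_projop[OF R]] by (intro sum.cong) auto
    finally show ?thesis
      using that resolution_finite[OF R] by (simp add: z_def bounded_clinear_diff[OF bR] U(2))
  qed
  have "(norm z)\<^sup>2 = (\<Sum>i\<in>J. (norm (R i z))\<^sup>2)"
    by (rule resolution_norm[OF R])
  also have "\<dots> \<le> (\<Sum>i\<in>J. e\<^sup>2 * (norm (R i x))\<^sup>2)"
    by (rule sum_mono) (simp add: Rz power_mono le flip: power_mult_distrib)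
  also have "\<dots> = (e * norm x)\<^sup>2"
    by (simp add: resolution_norm[OF R, of x] sum_distrib_left power_mult_distrib)
  finally have "norm z \<le> e * norm x"
    by (rule power2_le_imp_le) (simp add: e)
  then show ?thesis by (simp add: z_def)
qed

lemma unitary_finite_spectrum_approx:
  fixes U :: "'a::chilbert \<Rightarrow> 'a"
  assumes U: "unitary U" and e: "e > 0"
  obtains J :: "(nat \<times> nat) set" and R lam where "resolution J R" "\<And>i. cmod (lam i) = 1"
    "\<And>x. norm (U x - (\<Sum>i\<in>J. scaleC (lam i) (R i x))) \<le> e * norm x"
proof -
  \<comment> \<open>Real and imaginary part contribute d each, and moving c to the unit circle costs
    at most 2d more.\<close>
  define d where "d = e / 4"
  have d: "d > 0" using e by (simp add: d_def)
  obtain A B where A: "symop A" and B: "symop B" and A1: "\<And>x. norm (A x) \<le> norm x"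
    and B1: "\<And>x. norm (B x) \<le> norm x" and AB: "\<And>x. A (B x) = B (A x)"
    and U_eq: "\<And>x. U x = A x + scaleC \<i> (B x)"
    using unitary_cartesian_decomposition[OF U] by metis
  have bU: "bounded_clinear U" using U by (simp add: unitary_def)
  have nU: "norm (U x) = norm x" for x using unitaryE[OF U] by metis
  obtain m P a where P: "resolution {..<m::nat} P"
    and comP: "\<And>T k x. symop T \<Longrightarrow> (\<And>x. T (A x) = A (T x)) \<Longrightarrow> T (P k x) = P k (T x)"
    and leP: "\<And>k x. norm (A (P k x) - scaleC (complex_of_real (a k)) (P k x)) \<le> d * norm (P k x)"
    using spectral_resolution[OF A A1 d] by blast
  obtain n Q b where Q: "resolution {..<n::nat} Q"
    and comQ: "\<And>T k x. symop T \<Longrightarrow> (\<And>x. T (B x) = B (T x)) \<Longrightarrow> T (Q k x) = Q k (T x)"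
    and leQ: "\<And>k x. norm (B (Q k x) - scaleC (complex_of_real (b k)) (Q k x)) \<le> d * norm (Q k x)"
    using spectral_resolution[OF B B1 d] by blast
  note sP = projop_symop[OF resolution_projop[OF P]]
  have AP: "A (P k x) = P k (A x)" for k x by (rule comP[OF A]) simp
  have BQ: "B (Q k x) = Q k (B x)" for k x by (rule comQ[OF B]) simp
  have BP: "B (P k x) = P k (B x)" for k x by (rule comP[OF B]) (simp add: AB)
  have AQ: "A (Q k x) = Q k (A x)" for k x by (rule comQ[OF A]) (simp add: AB)
  have PQ: "P k (Q l x) = Q l (P k x)" for k l x by (rule comQ[OF sP]) (simp add: BP)
  define R where "R = (\<lambda>(k, l) x. P k (Q l x))"
  have R: "resolution ({..<m} \<times> {..<n}) R"
    unfolding R_def by (rule resolution_product[OF P Q PQ])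
  note sQ = projop_symop[OF resolution_projop[OF Q]]
  have UR: "U (R i x) = R i (U x)" for i x
    by (simp add: R_def split_def U_eq AP BP AQ BQ symop_simps[OF sP] symop_simps[OF sQ])
  have "\<exists>l. cmod l = 1 \<and> (\<forall>x. norm (U (R i x) - scaleC l (R i x)) \<le> e * norm (R i x))" for i
  proof -
    define c where "c = Complex (a (fst i)) (b (snd i))"
    have c: "norm (U (R i x) - scaleC c (R i x)) \<le> 2 * d * norm (R i x)" for x
    proof -
      define z where "z = R i x"
      have zP: "z = P (fst i) (Q (snd i) x)" and zQ: "z = Q (snd i) (P (fst i) x)"
        by (simp_all add: z_def R_def split_def PQ)
      have "c = complex_of_real (a (fst i)) + \<i> * complex_of_real (b (snd i))"
        by (simp add: c_def complex_eq_iff)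
      then have "U z - scaleC c z = (A z - scaleC (complex_of_real (a (fst i))) z)
          + scaleC \<i> (B z - scaleC (complex_of_real (b (snd i))) z)"
        by (simp add: U_eq scaleC_add_left cvs.scale_right_diff_distrib scaleC_scaleC)
      also have "norm \<dots> \<le> norm (A z - scaleC (complex_of_real (a (fst i))) z)
          + norm (B z - scaleC (complex_of_real (b (snd i))) z)"
        by (rule order.trans[OF norm_triangle_ineq]) simp
      also have "\<dots> \<le> d * norm z + d * norm z"
        using leP[of "fst i" "Q (snd i) x"] leQ[of "snd i" "P (fst i) x"]
        by (intro add_mono) (simp_all flip: zP zQ)
      finally show ?thesis by (simp add: z_def)
    qed
    obtain l where l: "cmod l = 1" "cmod (c - l) = \<bar>cmod c - 1\<bar>"
      using unit_complex_near by blast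
    have "norm (U (R i x) - scaleC l (R i x)) \<le> e * norm (R i x)" for x
    proof -
      define z where "z = R i x"
      \<comment> \<open>Since \<open>U\<close> is isometric, closeness of \<open>U z\<close> to c z
        bounds the deviation of the modulus of c from 1.\<close>
      have eq: "norm (scaleC c z) - norm (U z) = (cmod c - 1) * norm z"
        by (simp add: nU left_diff_distrib)
      have "\<bar>cmod c - 1\<bar> * norm z = \<bar>norm (scaleC c z) - norm (U z)\<bar>"
        unfolding eq by (simp add: abs_mult)
      also have "\<dots> \<le> 2 * d * norm z"
        using c[of x] norm_triangle_ineq3[of "scaleC c z" "U z"]
        by (simp add: z_def norm_minus_commute)
      finally have "norm (scaleC (c - l) z) \<le> 2 * d * norm z" by (simp add: l)
      moreover have "U z - scaleC l z = (U z - scaleC c z) + scaleC (c - l) z"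
        by (simp add: cvs.scale_left_diff_distrib)
      then have "norm (U z - scaleC l z) \<le> norm (U z - scaleC c z) + norm (scaleC (c - l) z)"
        by (simp only: norm_triangle_ineq)
      ultimately show ?thesis
        using c[of x] by (simp add: z_def d_def)
    qed
    then show ?thesis using l(1) by blast
  qed
  then obtain lam where lam: "\<And>i. cmod (lam i) = 1"
    and le: "\<And>i x. norm (U (R i x) - scaleC (lam i) (R i x)) \<le> e * norm (R i x)"
    by metis
  show ?thesis
    by (rule that[OF R lam resolution_approx[OF R bU UR _ le]]) (use e in auto)
qed

section \<open>Orthonormal sequences and diagonal operators\<close>

text \<open>Zero vectors are allowed, so that Gram--Schmidt can be run on linearly dependent sequences.\<close>

locale orthonormal_seq =
  fixes e :: "nat \<Rightarrow> 'a::chilbert"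
  assumes orth: "i \<noteq> j \<Longrightarrow> cinner (e i) (e j) = 0"
    and unit_or_0: "e i = 0 \<or> norm (e i) = 1"
begin

text \<open>The self inner product is 1 or 0, and it is 0 only where the coefficient vanishes too;
  this absorbs the zero vectors.\<close>

lemma cinner_e_self: "cinner (e k) x * cinner (e k) (e k) = cinner (e k) x"
  using unit_or_0[of k] by (auto simp: cinner_self_norm)

lemma norm_e_le: "norm (e k) \<le> 1"
  using unit_or_0[of k] by auto

lemma norm_sum_sq_le:
  assumes "finite F"
  shows "(norm (\<Sum>k\<in>F. scaleC (b k) (e k)))\<^sup>2 \<le> (\<Sum>k\<in>F. (cmod (b k))\<^sup>2)"
  using assms
proof (induction F)
  case (insert j F)
  have "cinner (scaleC (b j) (e j)) (\<Sum>k\<in>F. scaleC (b k) (e k)) = 0"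
    unfolding cinner_sum_right using insert.hyps
    by (intro sum.neutral ballI)
      (metis cinner_scaleC_left cinner_scaleC_right mult_zero_right orth)
  then have "(norm (\<Sum>k\<in>insert j F. scaleC (b k) (e k)))\<^sup>2
      = (norm (scaleC (b j) (e j)))\<^sup>2 + (norm (\<Sum>k\<in>F. scaleC (b k) (e k)))\<^sup>2"
    using insert.hyps by (simp add: norm_add_sq)
  moreover have "(norm (scaleC (b j) (e j)))\<^sup>2 \<le> (cmod (b j))\<^sup>2"
    using norm_e_le[of j] by (intro power_mono) (auto simp: mult_left_le)
  ultimately show ?case
    using insert by (simp only: sum.insert[OF insert.hyps, of "\<lambda>k. (cmod (b k))\<^sup>2"] add_mono)
qed simp

lemma bessel:
  assumes "finite F"
  shows "(\<Sum>k\<in>F. (cmod (cinner (e k) x))\<^sup>2) \<le> (norm x)\<^sup>2"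
proof -
  define p where "p = (\<Sum>k\<in>F. scaleC (cinner (e k) x) (e k))"
  have "cinner x p = complex_of_real (\<Sum>k\<in>F. (cmod (cinner (e k) x))\<^sup>2)"
    unfolding p_def cinner_sum_right of_real_sum
  proof (rule sum.cong[OF refl])
    fix k
    show "cinner x (scaleC (cinner (e k) x) (e k)) = complex_of_real ((cmod (cinner (e k) x))\<^sup>2)"
      by (simp only: cinner_scaleC_right cinner_commute[of x "e k"] complex_norm_square)
  qed
  moreover have "(norm p)\<^sup>2 \<le> (\<Sum>k\<in>F. (cmod (cinner (e k) x))\<^sup>2)"
    unfolding p_def by (rule norm_sum_sq_le[OF assms])
  ultimately show ?thesis
    using norm_diff_sq[of x p] zero_le_power2[of "norm (x - p)"] by simp
qed

lemma summable_coeffs: "summable (\<lambda>k. (cmod (cinner (e k) x))\<^sup>2)"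
  by (rule summableI_nonneg_bounded[of _ "(norm x)\<^sup>2"]) (auto intro: bessel)

lemma suminf_coeffs_le: "(\<Sum>k. (cmod (cinner (e k) x))\<^sup>2) \<le> (norm x)\<^sup>2"
  by (rule suminf_le_const[OF summable_coeffs]) (auto intro: bessel)

lemma summable_series:
  assumes "summable (\<lambda>k. (cmod (b k))\<^sup>2)"
  shows "summable (\<lambda>k. scaleC (b k) (e k))"
  unfolding summable_Cauchy
proof (intro allI impI)
  fix d :: real assume "d > 0"
  then obtain N where N: "\<And>m n. m \<ge> N \<Longrightarrow> norm (\<Sum>k=m..<n. (cmod (b k))\<^sup>2) < d\<^sup>2"
    using assms unfolding summable_Cauchy by (meson zero_less_power)
  have "norm (\<Sum>k=m..<n. scaleC (b k) (e k)) < d" if "m \<ge> N" for m n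
  proof -
    have "(norm (\<Sum>k=m..<n. scaleC (b k) (e k)))\<^sup>2 < d\<^sup>2"
      using norm_sum_sq_le[of "{m..<n}" b] N[OF that, of n] by auto
    then show ?thesis using \<open>d > 0\<close> by (simp add: power2_less_imp_less)
  qed
  then show "\<exists>N. \<forall>m\<ge>N. \<forall>n. norm (\<Sum>k=m..<n. scaleC (b k) (e k)) < d" by blast
qed

lemma norm_series_sq_le:
  assumes "summable (\<lambda>k. (cmod (b k))\<^sup>2)"
  shows "(norm (\<Sum>k. scaleC (b k) (e k)))\<^sup>2 \<le> (\<Sum>k. (cmod (b k))\<^sup>2)"
proof (rule LIMSEQ_le_const2)
  show "(\<lambda>n. (norm (\<Sum>k<n. scaleC (b k) (e k)))\<^sup>2) \<longlonglongrightarrow> (norm (\<Sum>k. scaleC (b k) (e k)))\<^sup>2"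
    by (intro tendsto_intros summable_LIMSEQ summable_series assms)
  have "(norm (\<Sum>k<n. scaleC (b k) (e k)))\<^sup>2 \<le> (\<Sum>k. (cmod (b k))\<^sup>2)" for n
    using norm_sum_sq_le[of "{..<n}" b] sum_le_suminf[OF assms, of "{..<n}"] by force
  then show "\<exists>N. \<forall>n\<ge>N. (norm (\<Sum>k<n. scaleC (b k) (e k)))\<^sup>2 \<le> (\<Sum>k. (cmod (b k))\<^sup>2)" by blast
qed

lemma cinner_series:
  assumes "summable (\<lambda>k. (cmod (b k))\<^sup>2)"
  shows "cinner (e j) (\<Sum>k. scaleC (b k) (e k)) = b j * cinner (e j) (e j)"
proof -
  have "cinner (e j) (\<Sum>k. scaleC (b k) (e k)) = (\<Sum>k. cinner (e j) (scaleC (b k) (e k)))"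
    by (rule bounded_linear.suminf[OF bounded_linear_cinner_right summable_series[OF assms]])
  also have "\<dots> = (\<Sum>k\<in>{j}. cinner (e j) (scaleC (b k) (e k)))"
    by (rule suminf_finite) (auto simp: cinner_simps orth)
  finally show ?thesis by (simp add: cinner_simps)
qed

definition diag :: "(nat \<Rightarrow> complex) \<Rightarrow> 'a \<Rightarrow> 'a" where
  "diag m x = (\<Sum>k. scaleC (m k * cinner (e k) x) (e k))"

context
  fixes m :: "nat \<Rightarrow> complex" and c :: real
  assumes m_le: "cmod (m k) \<le> c"
begin

lemma coeff_le: "(cmod (m k * cinner (e k) x))\<^sup>2 \<le> c\<^sup>2 * (cmod (cinner (e k) x))\<^sup>2"
  using m_le[of k] by (simp add: norm_mult power_mult_distrib mult_right_mono power_mono)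

lemma summable_diag_coeffs: "summable (\<lambda>k. (cmod (m k * cinner (e k) x))\<^sup>2)"
  by (rule summable_comparison_test'[OF summable_mult[OF summable_coeffs[of x], of "c\<^sup>2"], of 0])
    (use coeff_le in auto)

lemma summable_diag: "summable (\<lambda>k. scaleC (m k * cinner (e k) x) (e k))"
  by (rule summable_series[OF summable_diag_coeffs])

lemma cinner_diag: "cinner (e j) (diag m x) = m j * cinner (e j) x"
  unfolding diag_def cinner_series[OF summable_diag_coeffs] by (simp add: cinner_e_self mult.assoc)

lemma norm_diag_le: "norm (diag m x) \<le> c * norm x"
proof (rule power2_le_imp_le)
  have "(norm (diag m x))\<^sup>2 \<le> (\<Sum>k. (cmod (m k * cinner (e k) x))\<^sup>2)"
    unfolding diag_def by (rule norm_series_sq_le[OF summable_diag_coeffs])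
  also have "\<dots> \<le> (\<Sum>k. c\<^sup>2 * (cmod (cinner (e k) x))\<^sup>2)"
    by (rule suminf_le[OF coeff_le summable_diag_coeffs summable_mult[OF summable_coeffs]])
  also have "\<dots> = c\<^sup>2 * (\<Sum>k. (cmod (cinner (e k) x))\<^sup>2)"
    by (rule suminf_mult[OF summable_coeffs])
  also have "\<dots> \<le> (c * norm x)\<^sup>2"
    using suminf_coeffs_le[of x] by (simp add: power_mult_distrib mult_left_mono)
  finally show "(norm (diag m x))\<^sup>2 \<le> (c * norm x)\<^sup>2" .
  show "0 \<le> c * norm x"
    using order.trans[OF norm_ge_zero m_le[of 0]] by simp
qed

end

lemma cinner_diag_adjoint:
  assumes m_le: "\<And>k. cmod (m k) \<le> c"
  shows "cinner (diag m x) y = cinner x (diag (\<lambda>k. cnj (m k)) y)"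
proof -
  have m_le': "cmod (cnj (m k)) \<le> c" for k by (simp add: m_le)
  have "cinner (diag m x) y = (\<Sum>k. cinner (scaleC (m k * cinner (e k) x) (e k)) y)"
    unfolding diag_def
    by (rule bounded_linear.suminf[OF bounded_linear_cinner_left summable_diag[of m, OF m_le]])
  also have "\<dots> = (\<Sum>k. cinner x (scaleC (cnj (m k) * cinner (e k) y) (e k)))"
    by (simp add: cinner_simps cinner_commute[of x] mult_ac)
  also have "\<dots> = cinner x (diag (\<lambda>k. cnj (m k)) y)"
    unfolding diag_def
    by (rule bounded_linear.suminf[OF bounded_linear_cinner_right summable_diag[OF m_le'], symmetric])
  finally show ?thesis .
qed

end

locale orthonormal_basis = orthonormal_seq +
  assumes total: "(\<And>k. cinner (e k) x = 0) \<Longrightarrow> x = 0"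
begin

text \<open>Reduces vector identities to coefficients, so that the series behind \<open>diag\<close>
  need not be manipulated.\<close>

lemma basis_ext: "(\<And>k. cinner (e k) x = cinner (e k) y) \<Longrightarrow> x = y"
  using total[of "x - y"] by (simp add: cinner_diff_right)

lemma basis_expansion: "x = (\<Sum>k. scaleC (cinner (e k) x) (e k))"
  by (rule basis_ext) (simp add: cinner_series[OF summable_coeffs] cinner_e_self)

lemma bounded_clinear_diag:
  assumes m_le: "\<And>k. cmod (m k) \<le> c"
  shows "bounded_clinear (diag m)"
proof (rule bounded_clinear_intro)
  show "diag m (x + y) = diag m x + diag m y" for x y
    by (rule basis_ext) (simp add: cinner_diag[of m, OF m_le] cinner_simps distrib_left)
  show "diag m (scaleC a x) = scaleC a (diag m x)" for a x
    by (rule basis_ext) (simp add: cinner_diag[of m, OF m_le] cinner_simps)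
  show "norm (diag m x) \<le> c * norm x" for x
    by (rule norm_diag_le[of m, OF m_le])
qed

lemma unitary_diag:
  assumes unit: "\<And>k. cmod (m k) = 1"
  shows "unitary (diag m)"
proof -
  define m' where "m' = (\<lambda>k. cnj (m k))"
  have le: "\<And>k. cmod (m k) \<le> 1" "\<And>k. cmod (m' k) \<le> 1" by (simp_all add: unit m'_def)
  note cd = cinner_diag[of m, OF le(1)] cinner_diag[of m', OF le(2)]
  have mm: "m k * m' k = 1" for k
    using complex_norm_square[of "m k"] by (simp add: unit m'_def)
  have inv: "diag m (diag m' x) = x" "diag m' (diag m x) = x" for x
    by (rule basis_ext, simp add: cd mm mult.assoc[symmetric] mult.commute[of "m' _"])+
  show ?thesis
    unfolding unitary_def is_adjoint_def
    using bounded_clinear_diag[of m, OF le(1)] bounded_clinear_diag[of m', OF le(2)]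
      cinner_diag_adjoint[of m, OF le(1)] inv
    by (intro conjI exI[of _ "diag m'"]) (auto simp: fun_eq_iff m'_def)
qed

end

subsection \<open>Gram--Schmidt\<close>

text \<open>A vector dependent on its predecessors leaves z = 0 and yields 0. Every index is kept,
  and no independent subsequence has to be selected.\<close>

function gram_schmidt :: "(nat \<Rightarrow> 'a::complex_inner) \<Rightarrow> nat \<Rightarrow> 'a" where
  "gram_schmidt v k =
    (let z = v k - (\<Sum>i<k. scaleC (cinner (gram_schmidt v i) (v k)) (gram_schmidt v i))
     in scaleC (complex_of_real (1 / norm z)) z)"
  by auto
termination by (relation "Wellfounded.measure snd") auto

declare gram_schmidt.simps [simp del]

definition gs_residue :: "(nat \<Rightarrow> 'a::complex_inner) \<Rightarrow> nat \<Rightarrow> 'a" where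
  "gs_residue v k = v k - (\<Sum>i<k. scaleC (cinner (gram_schmidt v i) (v k)) (gram_schmidt v i))"

lemma gram_schmidt_eq:
  "gram_schmidt v k = scaleC (complex_of_real (1 / norm (gs_residue v k))) (gs_residue v k)"
  unfolding gs_residue_def by (subst gram_schmidt.simps) (simp add: Let_def)

lemma gram_schmidt_unit_or_0: "gram_schmidt v k = 0 \<or> norm (gram_schmidt v k) = 1"
  by (cases "gs_residue v k = 0") (auto simp: gram_schmidt_eq[of v k] norm_divide)

lemma gram_schmidt_orth_less: "i < k \<Longrightarrow> cinner (gram_schmidt v i) (gram_schmidt v k) = 0"
proof (induction k arbitrary: i rule: less_induct)
  case (less k)
  let ?e = "gram_schmidt v"
  have orth: "cinner (?e i) (?e j) = 0" if "j < k" "j \<noteq> i" for j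
    using less.IH[of j i] less.IH[of i j] that less.prems cinner_eq_zero_commute[of "?e i" "?e j"]
    by (cases i j rule: linorder_cases) auto
  have "cinner (?e i) (gs_residue v k) = cinner (?e i) (v k)
      - (\<Sum>j<k. if j = i then cinner (?e i) (v k) * cinner (?e i) (?e i) else 0)"
    unfolding gs_residue_def cinner_diff_right cinner_sum_right cinner_scaleC_right
    by (intro arg_cong2[where f = minus] refl sum.cong) (auto simp: orth)
  also have "\<dots> = 0"
    using less.prems gram_schmidt_unit_or_0[of v i] by (auto simp: cinner_self_norm)
  finally show ?case by (simp add: gram_schmidt_eq[of v k] cinner_scaleC_right)
qed

lemma orthonormal_seq_gram_schmidt: "orthonormal_seq (gram_schmidt v)"
proof
  show "cinner (gram_schmidt v i) (gram_schmidt v j) = 0" if "i \<noteq> j" for i j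
    using that gram_schmidt_orth_less[of i j v] gram_schmidt_orth_less[of j i v] cinner_eq_zero_commute
    by (metis linorder_neqE_nat)
qed (rule gram_schmidt_unit_or_0)

lemma gram_schmidt_total:
  assumes "\<And>k. cinner (gram_schmidt v k) x = 0"
  shows "cinner (v k) x = 0"
proof -
  have "gs_residue v k = scaleC (complex_of_real (norm (gs_residue v k))) (gram_schmidt v k)"
    by (cases "gs_residue v k = 0") (auto simp: gram_schmidt_eq[of v k] scaleC_scaleC scaleC_one)
  then have "cinner (gs_residue v k) x = 0"
    using assms by (metis cinner_scaleC_left mult_zero_right)
  then show ?thesis
    by (simp add: gs_residue_def cinner_diff_left cinner_sum_left cinner_scaleC_left assms)
qed

text \<open>Vectors from different ranges are orthogonal, so only predecessors from the range of
  \<open>R (f k)\<close> are really subtracted. One run on an interleaved sequence thus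
  orthonormalises all ranges at once.\<close>

lemma gram_schmidt_resolution:
  assumes R: "resolution J R" and v: "\<And>k. R (f k) (v k) = v k"
  shows "R (f k) (gram_schmidt v k) = gram_schmidt v k"
proof (induction k rule: less_induct)
  case (less k)
  let ?e = "gram_schmidt v"
  note sR = projop_symop[OF resolution_projop[OF R]]
  note bR = symop_bounded_clinear[OF sR]
  have "R (f k) (scaleC (cinner (?e i) (v k)) (?e i)) = scaleC (cinner (?e i) (v k)) (?e i)"
    if "i < k" for i
  proof (cases "f i = f k")
    case True
    then show ?thesis using less[OF that] by (simp add: symop_simps[OF sR])
  next
    case False
    have "cinner (?e i) (v k) = cinner (R (f i) (?e i)) (R (f k) (v k))"
      by (simp add: less[OF that] v)
    also have "\<dots> = cinner (?e i) (R (f i) (R (f k) (v k)))"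
      by (rule symop_cinner[OF sR])
    also have "\<dots> = 0"
      by (simp add: resolution_orth[OF R False])
    finally show ?thesis by (simp add: symop_simps[OF sR])
  qed
  then have "R (f k) (gs_residue v k) = gs_residue v k"
    by (simp add: gs_residue_def symop_simps(3)[OF sR] bounded_clinear_sum[OF bR] v)
  then show ?case
    by (simp add: gram_schmidt_eq[of v k] symop_simps(2)[OF sR])
qed

section \<open>Cyclic vectors of diagonal operators\<close>

text \<open>The geometric sums stay bounded by 2 / |w - 1|, while the denominator grows.\<close>

lemma average_powers_tendsto_0:
  fixes w :: complex
  assumes "cmod w = 1" "w \<noteq> 1"
  shows "(\<lambda>N. (\<Sum>n<N. w ^ n) / of_nat N) \<longlonglongrightarrow> 0"
proof (rule Lim_null_comparison)
  have "cmod ((\<Sum>n<N. w ^ n) / of_nat N) \<le> (2 / cmod (w - 1)) * (1 / real N)" for N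
  proof -
    have "(\<Sum>n<N. w ^ n) = (w ^ N - 1) / (w - 1)"
      using assms by (simp add: geometric_sum)
    then have "cmod (\<Sum>n<N. w ^ n) = cmod (w ^ N - 1) / cmod (w - 1)"
      by (simp add: norm_divide)
    also have "cmod (w ^ N - 1) \<le> 2"
      using norm_triangle_ineq4[of "w ^ N" 1] assms by (simp add: norm_power)
    finally have "cmod (\<Sum>n<N. w ^ n) \<le> 2 / cmod (w - 1)"
      by (simp add: divide_right_mono)
    then have "cmod (\<Sum>n<N. w ^ n) / real N \<le> 2 / cmod (w - 1) / real N"
      by (rule divide_right_mono) simp
    then show ?thesis
      by (simp add: norm_divide)
  qed
  then show "\<forall>\<^sub>F N in sequentially. cmod ((\<Sum>n<N. w ^ n) / of_nat N)
      \<le> (2 / cmod (w - 1)) * (1 / real N)"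
    by simp
  show "(\<lambda>N. (2 / cmod (w - 1)) * (1 / real N)) \<longlonglongrightarrow> 0"
    using tendsto_mult[OF tendsto_const[of "2 / cmod (w - 1)"] lim_1_over_n] by simp
qed

text \<open>Averaging \<open>cnj (w k) ^ n\<close> times the \<open>n\<close>-th moment over \<open>n < N\<close> isolates \<open>b k\<close> as \<open>N \<rightarrow> \<infinity>\<close>.\<close>

lemma vanishing_moments:
  fixes b w :: "nat \<Rightarrow> complex"
  assumes b: "summable (\<lambda>j. cmod (b j))" and w: "\<And>j. cmod (w j) = 1" "inj w"
    and moments: "\<And>n. (\<Sum>j. b j * w j ^ n) = 0"
  shows "b k = 0"
proof -
  \<comment> \<open>The rotation moves the k-th node to 1, the only one whose powers do not average
    out.\<close>
  define u where "u j = w j * cnj (w k)" for j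
  have u1: "cmod (u j) = 1" for j by (simp add: u_def w norm_mult)
  have uk: "u k = 1" using complex_norm_square[of "w k"] by (simp add: u_def w)
  have u_neq: "u j \<noteq> 1" if "j \<noteq> k" for j
  proof
    assume "u j = 1"
    then have "w j * (cnj (w k) * w k) = w k" by (simp add: u_def flip: mult.assoc)
    moreover have "cnj (w k) * w k = 1" using uk by (simp add: u_def mult.commute)
    ultimately have "w j = w k" by simp
    then show False using w(2) that by (simp add: inj_eq)
  qed
  have summable_u: "summable (\<lambda>j. b j * u j ^ n)" for n
    by (rule summable_norm_cancel) (simp add: norm_mult norm_power u1 b)
  have summable_w: "summable (\<lambda>j. b j * w j ^ n)" for n
    by (rule summable_norm_cancel) (simp add: norm_mult norm_power w b)
  have zero: "(\<Sum>j. b j * u j ^ n) = 0" for n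
  proof -
    have "(\<Sum>j. b j * u j ^ n) = (\<Sum>j. cnj (w k) ^ n * (b j * w j ^ n))"
      by (simp add: u_def power_mult_distrib mult_ac)
    also have "\<dots> = 0" by (simp add: suminf_mult[OF summable_w] moments)
    finally show ?thesis .
  qed
  define avg where "avg j N = b j * ((\<Sum>n<N. u j ^ n) / of_nat N)" for j N
  have avg_le: "cmod (avg j N) \<le> cmod (b j)" for j N
  proof -
    have "cmod (\<Sum>n<N. u j ^ n) \<le> real N"
      using norm_sum[of "\<lambda>n. u j ^ n" "{..<N}"] by (simp add: norm_power u1)
    then have "cmod ((\<Sum>n<N. u j ^ n) / of_nat N) \<le> 1"
      by (cases "N = 0") (simp_all add: norm_divide)
    then show ?thesis unfolding avg_def norm_mult by (rule mult_left_le) simp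
  qed
  have avg_0: "(\<Sum>j. avg j N) = 0" for N
  proof -
    have "(\<Sum>j. avg j N) = (\<Sum>j. (\<Sum>n<N. b j * u j ^ n) / of_nat N)"
      by (simp add: avg_def sum_distrib_left)
    also have "\<dots> = (\<Sum>j. (\<Sum>n<N. b j * u j ^ n)) / of_nat N"
      by (intro suminf_divide summable_sum summable_u)
    also have "(\<Sum>j. (\<Sum>n<N. b j * u j ^ n)) = 0"
      by (simp add: suminf_sum summable_u zero)
    finally show ?thesis by simp
  qed
  have "(\<lambda>N. \<Sum>j. avg j N) \<longlonglongrightarrow> b k"
  \<comment> \<open>The bound |avg j N| <= |b j|, uniform in N, permits taking the limit in N term
    by term.\<close>
  proof (rule swap_uniform_limit')
    show "uniform_limit UNIV (\<lambda>n N. \<Sum>j<n. avg j N) (\<lambda>N. \<Sum>j. avg j N) sequentially"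
      by (rule Weierstrass_m_test[OF avg_le b])
    have "avg j \<longlonglongrightarrow> (if j = k then b k else 0)" for j
    proof (cases "j = k")
      case True
      have "\<forall>\<^sub>F N in sequentially. avg j N = b k"
        using eventually_gt_at_top[of 0] by eventually_elim (simp add: True avg_def uk)
      then show ?thesis using True by (simp add: tendsto_eventually)
    next
      case False
      then show ?thesis
        using tendsto_mult[OF tendsto_const[of "b j"] average_powers_tendsto_0[OF u1 u_neq[OF False]]]
        by (simp add: avg_def[abs_def])
    qed
    then show "\<forall>\<^sub>F n in sequentially.
        ((\<lambda>N. \<Sum>j<n. avg j N) \<longlonglongrightarrow> (\<Sum>j<n. if j = k then b k else 0))"
      by (intro always_eventually allI tendsto_sum)
    show "(\<lambda>n. \<Sum>j<n. if j = k then b k else 0) \<longlonglongrightarrow> b k"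
      using sums_single[of k "\<lambda>j. b k"] by (simp add: sums_def)
  qed auto
  then show ?thesis by (simp add: avg_0 LIMSEQ_const_iff)
qed

section \<open>Density of spans and cyclicity\<close>

lemma subspace_closure:
  assumes "cvs.subspace (M :: 'a::complex_inner set)"
  shows "cvs.subspace (closure M)"
proof -
  have "0 \<in> closure M" using cvs.subspace_0[OF assms] closure_subset by blast
  moreover have "x + y \<in> closure M" if xy: "x \<in> closure M" "y \<in> closure M" for x y
  proof -
    obtain f g where "\<forall>n. f n \<in> M" "f \<longlonglongrightarrow> x" "\<forall>n. g n \<in> M" "g \<longlonglongrightarrow> y"
      using xy unfolding closure_sequential by blast
    then show ?thesis
      unfolding closure_sequential
      by (intro exI[of _ "\<lambda>n. f n + g n"]) (auto intro: tendsto_add cvs.subspace_add[OF assms])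
  qed
  moreover have "scaleC c x \<in> closure M" if x: "x \<in> closure M" for c x
  proof -
    obtain f where "\<forall>n. f n \<in> M" "f \<longlonglongrightarrow> x"
      using x unfolding closure_sequential by blast
    then show ?thesis
      unfolding closure_sequential
      by (intro exI[of _ "\<lambda>n. scaleC c (f n)"])
        (auto intro: tendsto_scaleC cvs.subspace_scale[OF assms])
  qed
  ultimately show ?thesis by (simp add: cvs.subspace_def)
qed

text \<open>The residual of a projection onto the closed span is orthogonal to \<open>S\<close>,
  hence 0.\<close>

lemma cspan_dense_if_orthogonal_trivial:
  fixes S :: "'a::chilbert set"
  assumes "\<And>y. (\<And>x. x \<in> S \<Longrightarrow> cinner x y = 0) \<Longrightarrow> y = 0"
  shows "closure (cspan S) = UNIV"
proof -
  have "cvs.subspace (closure (cspan S))"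
    unfolding cspan_eq_span by (rule subspace_closure[OF cvs.subspace_span])
  from orthogonal_projection_exists[OF this closed_closure]
  have "\<exists>m\<in>closure (cspan S). \<forall>y\<in>closure (cspan S). cinner y (x - m) = 0" for x .
  moreover have "S \<subseteq> closure (cspan S)"
    unfolding cspan_eq_span using cvs.span_superset closure_subset by blast
  ultimately have "\<exists>m\<in>closure (cspan S). x - m = 0" for x
    using assms by (meson subsetD)
  then show ?thesis by auto
qed

context orthonormal_basis
begin

lemma cyclic_diag:
  assumes m: "\<And>k. cmod (m k) = 1" "inj m"
  shows "cyclic_op (diag m)"
proof -
  \<comment> \<open>Nowhere zero, so every coefficient of \<open>y\<close> can be recovered; the
    geometric decay also makes the moment weights \<open>b\<close> absolutely summable.\<close>
  define c where "c k = complex_of_real ((1/2) ^ k)" for k :: nat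
  have "summable (\<lambda>k. (cmod (c k))\<^sup>2)"
    using summable_geometric[of "1/4 :: real"]
    by (simp add: c_def norm_power power2_eq_square norm_divide flip: power_mult_distrib)
  define x where "x = (\<Sum>k. scaleC (c k) (e k))"
  have x: "cinner (e k) x = c k * cinner (e k) (e k)" for k
    unfolding x_def by (rule cinner_series) fact
  have m_le: "cmod (m k) \<le> 1" for k by (simp add: m)
  have pow: "cinner (e k) ((diag m ^^ n) x) = m k ^ n * (c k * cinner (e k) (e k))" for n k
    by (induction n) (simp_all add: x cinner_diag[of m, OF m_le])
  have "closure (cspan (range (\<lambda>n. (diag m ^^ n) x))) = UNIV"
  proof (rule cspan_dense_if_orthogonal_trivial)
    fix y assume "\<And>z. z \<in> range (\<lambda>n. (diag m ^^ n) x) \<Longrightarrow> cinner z y = 0"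
    then have y: "cinner y ((diag m ^^ n) x) = 0" for n
      using cinner_eq_zero_commute by blast
    define b where "b k = c k * cinner (e k) (e k) * cinner y (e k)" for k
    have "(\<Sum>k. b k * m k ^ n) = 0" for n
    proof -
      let ?z = "(diag m ^^ n) x"
      have "cinner y ?z = cinner y (\<Sum>k. scaleC (cinner (e k) ?z) (e k))"
        by (simp flip: basis_expansion)
      also have "\<dots> = (\<Sum>k. cinner y (scaleC (cinner (e k) ?z) (e k)))"
        by (rule bounded_linear.suminf[OF bounded_linear_cinner_right summable_series[OF summable_coeffs]])
      also have "\<dots> = (\<Sum>k. b k * m k ^ n)"
        by (simp add: cinner_scaleC_right pow b_def mult_ac)
      finally show ?thesis by (simp add: y)
    qed
    moreover have "summable (\<lambda>k. cmod (b k))"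
    proof (rule summable_comparison_test')
      show "summable (\<lambda>k. norm y * (1/2) ^ k)"
        by (intro summable_mult summable_geometric) simp
      show "norm (cmod (b k)) \<le> norm y * (1/2) ^ k" if "k \<ge> 0" for k
      proof -
        have "cmod (cinner y (e k)) \<le> norm y"
          using cauchy_schwarz[of y "e k"] norm_e_le[of k] mult_left_le[of "norm (e k)" "norm y"]
          by simp
        moreover have "cmod (cinner (e k) (e k)) \<le> 1"
          using unit_or_0[of k] by (auto simp: cinner_self_norm)
        ultimately have "cmod (cinner (e k) (e k)) * cmod (cinner y (e k)) \<le> 1 * norm y"
          by (intro mult_mono) auto
        then show ?thesis
          by (simp add: b_def c_def norm_mult norm_power norm_divide mult.assoc mult.commute[of "norm y"]
              divide_right_mono)
      qed
    qed
    ultimately have b0: "b k = 0" for k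
      using vanishing_moments[of b m] m by blast
    have "cinner (e k) y = 0" for k
      using b0[of k] unit_or_0[of k] cinner_eq_zero_commute[of y "e k"]
      by (auto simp: b_def c_def cinner_self_norm)
    then show "y = 0" by (rule total)
  qed
  then show ?thesis unfolding cyclic_op_def by blast
qed

end

section \<open>Density of the cyclic unitary operators\<close>

text \<open>Greedy choice: stage k excludes only the finitely many values already taken.\<close>

lemma inj_selection:
  fixes S :: "nat \<Rightarrow> 'b set"
  assumes "\<And>k. infinite (S k)"
  obtains f where "inj f" "\<And>k. f k \<in> S k"
proof -
  have "\<exists>f. \<forall>k. f k \<in> S k \<and> f k \<notin> f ` {..<k}"
  proof (rule dependent_wellorder_choice[where P = "\<lambda>f k r. r \<in> S k \<and> r \<notin> f ` {..<k}"])
    fix k and f :: "nat \<Rightarrow> 'b"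
    have "\<not> S k \<subseteq> f ` {..<k}"
      using assms[of k] finite_subset by blast
    then show "\<exists>r. r \<in> S k \<and> r \<notin> f ` {..<k}" by blast
  next
    show "(r \<in> S k \<and> r \<notin> f ` {..<k}) = (r \<in> S k \<and> r \<notin> g ` {..<k})"
      if "\<And>y. y < k \<Longrightarrow> f y = g y" for r k and f g :: "nat \<Rightarrow> 'b"
      using that by auto
  qed
  then obtain f where f: "\<And>k. f k \<in> S k" "\<And>k. f k \<notin> f ` {..<k}" by blast
  have "inj f"
  proof (rule linorder_injI)
    show "f i \<noteq> f j" if "i < j" for i j
      using f(2)[of j] that by (metis imageI lessThan_iff)
  qed
  then show ?thesis using that f(1) by blast
qed

text \<open>Rotating l by an angle t moves it by the chord 2 |sin (t/2)| <= t. Keeping t below 1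
  makes the rotations injective.\<close>

lemma infinite_unit_arc:
  assumes "cmod l = 1" "d > 0"
  shows "infinite {z. cmod z = 1 \<and> cmod (l - z) < d}"
proof -
  define f where "f t = l * exp (\<i> * complex_of_real t)" for t
  have "inj_on f {0<..<min d 1}"
  proof (rule inj_onI)
    fix s t assume st: "s \<in> {0<..<min d 1}" "t \<in> {0<..<min d 1}" "f s = f t"
    then have "exp (\<i> * complex_of_real s) = exp (\<i> * complex_of_real t)"
      using assms(1) by (auto simp: f_def)
    moreover have "\<bar>Im (\<i> * complex_of_real s) - Im (\<i> * complex_of_real t)\<bar> < 2 * pi"
      using st pi_gt3 by auto
    ultimately have "\<i> * complex_of_real s = \<i> * complex_of_real t"
      by (rule exp_complex_eqI[rotated])
    then show "s = t" by simp
  qed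
  moreover have "f ` {0<..<min d 1} \<subseteq> {z. cmod z = 1 \<and> cmod (l - z) < d}"
  proof safe
    fix t assume t: "t \<in> {0<..<min d 1}"
    show "cmod (f t) = 1" by (simp add: f_def norm_mult assms)
    have "l - f t = - (l * (exp (\<i> * complex_of_real t) - 1))"
      by (simp add: f_def algebra_simps)
    then have "cmod (l - f t) = 2 * \<bar>sin (t / 2)\<bar>"
      by (simp only: norm_minus_cancel norm_mult dist_exp_i_1 assms mult_1)
    also have "\<dots> \<le> t" using abs_sin_x_le_abs_x[of "t / 2"] t by simp
    finally show "cmod (l - f t) < d" using t by simp
  qed
  moreover have "infinite {0<..<min d 1}" using assms by simp
  ultimately show ?thesis by (meson finite_imageD finite_subset)
qed

section \<open>Orthonormal bases adapted to a resolution of the identity\<close>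

lemma separable_dense_sequence:
  assumes "separable_space (euclidean :: 'a::real_normed_vector topology)"
  obtains s :: "nat \<Rightarrow> 'a::real_normed_vector" where "closure (range s) = UNIV"
proof -
  obtain C :: "'a set" where C: "countable C" "closure C = UNIV"
    using assms unfolding separable_space_def by auto
  then have "C \<noteq> {}" by auto
  then have "range (from_nat_into C) = C" using C(1) by (rule range_from_nat_into)
  then show ?thesis using that[of "from_nat_into C"] C(2) by simp
qed

lemma orthogonal_dense_imp_0:
  fixes x :: "'a::complex_inner"
  assumes "closure (range s) = UNIV" "\<And>n::nat. cinner (s n) x = 0"
  shows "x = 0"
proof -
  obtain f where f: "\<forall>n. f n \<in> range s" "f \<longlonglongrightarrow> x"
    using assms(1) closure_sequential[of x "range s"] by auto
  have "cinner (f n) x = 0" for n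
    using f(1) assms(2) by (metis rangeE)
  then show ?thesis
    using tendsto_cinner_left[OF f(2), of x] by (simp add: LIMSEQ_const_iff)
qed

text \<open>Gram-Schmidt is run on an enumeration of all \<open>R i (s n)\<close> with
  \<open>s\<close> dense. A vector orthogonal to all of them is orthogonal to their sums over
  \<open>J\<close>, which are the \<open>s n\<close>.\<close>

lemma adapted_orthonormal_basis:
  fixes R :: "'i::countable \<Rightarrow> 'a::chilbert \<Rightarrow> 'a"
  assumes sep: "separable_space (euclidean :: 'a topology)" and R: "resolution J R"
  obtains e f where "orthonormal_basis e" "\<And>k. R (f k) (e k) = e k"
proof -
  obtain s :: "nat \<Rightarrow> 'a" where s: "closure (range s) = UNIV"
    using separable_dense_sequence[OF sep] by blast
  define g :: "nat \<Rightarrow> 'i \<times> nat" where "g = from_nat"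
  define v where "v k = R (fst (g k)) (s (snd (g k)))" for k
  have v: "R (fst (g k)) (v k) = v k" for k
    by (simp add: v_def projop_idem[OF resolution_projop[OF R]])
  interpret orthonormal_seq "gram_schmidt v" by (rule orthonormal_seq_gram_schmidt)
  have "orthonormal_basis (gram_schmidt v)"
  proof
    fix x assume "\<And>k. cinner (gram_schmidt v k) x = 0"
    then have vx: "cinner (v k) x = 0" for k by (rule gram_schmidt_total)
    have "cinner (R i (s n)) x = 0" for i n
      using vx[of "to_nat (i, n)"] by (simp add: v_def g_def)
    then have "cinner (\<Sum>i\<in>J. R i (s n)) x = 0" for n by (simp add: cinner_sum_left)
    then have "cinner (s n) x = 0" for n by (simp add: resolution_sum[OF R])
    then show "x = 0" by (rule orthogonal_dense_imp_0[OF s])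
  qed
  moreover have "R (fst (g k)) (gram_schmidt v k) = gram_schmidt v k" for k
    by (rule gram_schmidt_resolution[OF R, where f = "\<lambda>k. fst (g k)"]) (rule v)
  ultimately show ?thesis by (rule that)
qed

lemma cinner_resolution_combination:
  assumes R: "resolution J R" and y: "R j y = y"
  shows "cinner y (\<Sum>i\<in>J. scaleC (lam i) (R i x)) = lam j * cinner y x"
proof -
  note sR = projop_symop[OF resolution_projop[OF R]]
  have Ry: "cinner y (R i x) = (if i = j then cinner y x else 0)" for i
    using y resolution_orth[OF R, of i j y] by (auto simp flip: symop_cinner[OF sR])
  \<comment> \<open>Covers an index j outside \<open>J\<close>, possible only for y = 0; zero basis
    vectors may carry such an index.\<close>
  have "y = (\<Sum>i\<in>J. R i y)" by (simp add: resolution_sum[OF R])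
  also have "\<dots> = (\<Sum>i\<in>J. if i = j then y else 0)"
    using y resolution_orth[OF R, of _ j y] by (intro sum.cong) auto
  finally have "j \<notin> J \<Longrightarrow> y = 0"
    by (simp add: resolution_finite[OF R])
  then show ?thesis
    by (cases "j \<in> J") (auto simp: cinner_sum_right cinner_scaleC_right Ry resolution_finite[OF R] if_distrib cong: if_cong)
qed

theorem theorem4:
  assumes "separable_space (euclidean :: 'a::chilbert topology)"
    and "infinite_dimensional TYPE('a)"
    and "unitary (U :: 'a \<Rightarrow> 'a)"
    and "e > 0"
  shows "\<exists>V :: 'a \<Rightarrow> 'a. unitary V \<and> cyclic_op V \<and> onorm (\<lambda>x. U x - V x) < e"
proof -
  \<comment> \<open>The two approximations cost d each, and 2d stays strictly below e.\<close>
  define d where "d = e / 3"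
  have d: "d > 0" using assms(4) by (simp add: d_def)
  obtain J :: "(nat \<times> nat) set" and R lam where R: "resolution J R"
    and lam: "\<And>i. cmod (lam i) = 1"
    and U_le: "\<And>x. norm (U x - (\<Sum>i\<in>J. scaleC (lam i) (R i x))) \<le> d * norm x"
    using unitary_finite_spectrum_approx[OF assms(3) d] by blast
  obtain b f where "orthonormal_basis b" and f: "\<And>k. R (f k) (b k) = b k"
    using adapted_orthonormal_basis[OF assms(1) R] by blast
  then interpret orthonormal_basis b by simp
  define arc where "arc k = {z. cmod z = 1 \<and> cmod (lam (f k) - z) < d}" for k
  have "infinite (arc k)" for k
    unfolding arc_def by (rule infinite_unit_arc[OF lam d])
  then obtain \<mu> where inj: "inj \<mu>" and arc: "\<And>k. \<mu> k \<in> arc k"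
    using inj_selection by metis
  have unit: "cmod (\<mu> k) = 1" and \<mu>_le: "cmod (\<mu> k) \<le> 1" "cmod (lam (f k) - \<mu> k) \<le> d" for k
    using arc[of k] by (simp_all add: arc_def)
  \<comment> \<open>In the adapted basis the error is again diagonal, so its norm is controlled by
    its largest entry.\<close>
  have diff: "(\<Sum>i\<in>J. scaleC (lam i) (R i x)) - diag \<mu> x = diag (\<lambda>k. lam (f k) - \<mu> k) x" for x
    by (rule basis_ext)
      (simp add: cinner_diff_right cinner_resolution_combination[OF R f] left_diff_distrib
        cinner_diag[of \<mu>, OF \<mu>_le(1)] cinner_diag[of "\<lambda>k. lam (f k) - \<mu> k", OF \<mu>_le(2)])
  have "norm (U x - diag \<mu> x) \<le> (2 * d) * norm x" for x
  proof -
    let ?G = "\<Sum>i\<in>J. scaleC (lam i) (R i x)"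
    have "norm (U x - diag \<mu> x) \<le> norm (U x - ?G) + norm (?G - diag \<mu> x)"
      using norm_triangle_ineq[of "U x - ?G" "?G - diag \<mu> x"] by simp
    also have "norm (?G - diag \<mu> x) \<le> d * norm x"
      unfolding diff by (rule norm_diag_le[OF \<mu>_le(2)])
    finally show ?thesis using U_le[of x] by simp
  qed
  then have "onorm (\<lambda>x. U x - diag \<mu> x) \<le> 2 * d"
    using d by (intro onorm_bound) auto
  also have "\<dots> < e" using assms(4) by (simp add: d_def)
  finally show ?thesis
    by (intro exI[of _ "diag \<mu>"] conjI unitary_diag[of \<mu>, OF unit] cyclic_diag[of \<mu>, OF unit inj])
qed

end
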